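(* Let $X$ be a Banach space and $f_k:X\to\mathbb{R}\cup\{+\infty\}$ $(k\in\mathbb{N}\cup\{0\})$ proper convex functions such that $C:=\operatorname{dom}f_0\cap\{x: f_k(x)\le0\ \forall k\in\mathbb{N}\}\neq\emptyset$. Let $\bar x\in X$ be a solution of problem (P): minimize $f_0(x)$ subject to $f_k(x)\le0$ $(k\in\mathbb{N})$. Suppose the Slater condition holds (there exists $x\in\operatorname{dom}f_0$ with $\sup_{k\in\mathbb{N}}f_k(x)<0$), and there exists a solution $\lambda=(\lambda_1,\lambda_2,\ldots)\in\ell^1_+$, $\lambda_\infty\in\mathbb{R}_+$ of problem (D) such that (i) the functions $f_0$, $\lambda_kf_k$ $(k\in\mathbb{N}\cup\{\infty\})$ are lower semicontinuous and bounded from below on a neighbourhood of $\bar x$; (ii) the collection $\{f_0,\ \lambda_kf_k\ (k\in\mathbb{N}\cup\{\infty\})\}$ is uniformly lower semicontinuous on a neighbourhood of $\bar x$. Then $\lambda_kf_k(\bar x)=0$ for all $k\in\mathbb{N}\cup\{\infty\}$, and for any $\varepsilon>0$ and $M>0$ there exist $n\in\mathbb{N}$ with $n>M$ and points $x_k\in B_\varepsilon(\bar x)$ $(k=0,\ldots,n)$ and $x_\infty\in B_\varepsilon(\bar x)$ such that $$f_0(x_0)+\sum_{k=1}^n\lambda_kf_k(x_k)+\lambda_\infty f_\infty(x_\infty)\le f_0(\bar x),$$ $$0\in\partial f_0(x_0)+\sum_{k=1}^n\lambda_k\partial f_k(x_k)+\lambda_\infty\partial f_\infty(x_\infty)+\varepsilon\mathbb{B}^*,$$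 with the convention $\lambda_k\partial f_k(x_k)=N_{\operatorname{dom}f_k}(x_k)$ when $\lambda_k=0$ $(k\in\mathbb{N}\cup\{\infty\})$.
   Context: Conventions: $0\cdot(+\infty)=+\infty$ (so $0\cdot f_k$ is the indicator function of $\operatorname{dom}f_k$), $(+\infty)-(+\infty)=+\infty$. $f_\infty(x):=\limsup_{k\to\infty}f_k(x)$. (D) is the problem $\sup_{\lambda\in\ell^1_+,\lambda_\infty\ge0}\inf_{x\in X}\big(f_0(x)+\overline{\sum_{k\in\mathbb{N}}}\lambda_kf_k(x)+\lambda_\infty f_\infty(x)\big)$, where $\overline{\sum_{k\in\mathbb{N}}}\lambda_kf_k(x):=\limsup_{n\to\infty}\sum_{k=1}^n\lambda_kf_k(x)$ and $\ell^1_+$ is the set of nonnegative sequences in $\ell^1$; a solution attains the supremum. $B_\varepsilon(\bar x)$ is the open ball, $\mathbb{B}^*$ the open unit ball of $X^*$, $\partial$ the Fenchel subdifferential $\partial f(x)=\{x^*: f(y)-f(x)\ge\langle x^*,y-x\rangle\ \forall y\}$, and $N_A(x)$ the normal cone of convex analysis to $A$ at $x$. Uniform lower semicontinuity: for a nonempty index set $T$ (here $T=\mathbb{N}\cup\{0,\infty\}$ with $g_0=f_0$, $g_k=\lambda_kf_k$), let $\mathcal{F}(T)$ be the finite subsets of $T$ directed by inclusion, $\limsup_{S\uparrow T}\alpha_S:=\inf_{S_0}\sup_{S\supset S_0}\alpha_S$, $\liminf_{S\uparrow T}\alpha_S:=\sup_{S_0}\inf_{S\supset S_0}\alpha_S$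 over $S,S_0\in\mathcal{F}(T)$; $\big(\overline{\sum_{t\in T}}g_t\big)(x):=\limsup_{S\uparrow T}\sum_{t\in S}g_t(x)$; for $U\subset X$, $\Lambda_U(\{g_t\}):=\liminf_{S\uparrow T}\lim_{\delta\downarrow0}\inf\{\sum_{t\in S}g_t(x_t): x_t\in U,\ \operatorname{diam}\{x_t\}_{t\in S}<\delta\}$. The collection is uniformly lower semicontinuous on $U$ if $\inf_U\overline{\sum_{t\in T}}g_t\le\Lambda_U(\{g_t\})$. *)

theory Defs
  imports "HOL-Analysis.Analysis" "HOL-Library.Extended_Real" "HOL-Library.Extended_Nat"
begin

definition edom :: "('a \<Rightarrow> ereal) \<Rightarrow> 'a set" where
  "edom f = {x. f x < \<infinity>}"

definition proper_fun :: "('a \<Rightarrow> ereal) \<Rightarrow> bool" where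
  "proper_fun f \<longleftrightarrow> (\<forall>x. f x \<noteq> -\<infinity>) \<and> (\<exists>x. f x \<noteq> \<infinity>)"

definition convex_efun :: "('a::real_vector \<Rightarrow> ereal) \<Rightarrow> bool" where
  "convex_efun f \<longleftrightarrow> (\<forall>x y. \<forall>t::real. 0 < t \<and> t < 1 \<longrightarrow>
      f ((1 - t) *\<^sub>R x + t *\<^sub>R y) \<le> ereal (1 - t) * f x + ereal t * f y)"

definition smul :: "real \<Rightarrow> ereal \<Rightarrow> ereal" where
  "smul c v = (if c = 0 then (if v = \<infinity> then \<infinity> else 0) else ereal c * v)"

definition lsc_at :: "('a::topological_space \<Rightarrow> ereal) \<Rightarrow> 'a \<Rightarrow> bool" where
  "lsc_at f x \<longleftrightarrow> f x \<le> Liminf (at x) f"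

definition finf :: "(nat \<Rightarrow> 'a \<Rightarrow> ereal) \<Rightarrow> 'a \<Rightarrow> ereal" where
  "finf f x = limsup (\<lambda>k. f k x)"

(* nonnegative l^1 sequences (indexed by k \<ge> 1; the value at 0 is unused) *)
definition l1_plus :: "(nat \<Rightarrow> real) set" where
  "l1_plus = {lam. (\<forall>k\<ge>1. 0 \<le> lam k) \<and> summable lam}"

(* Lagrangian of (D); ereal addition satisfies (+\<infinity>) + (-\<infinity>) = +\<infinity> *)
definition lagr :: "(nat \<Rightarrow> 'a \<Rightarrow> ereal) \<Rightarrow> (nat \<Rightarrow> real) \<Rightarrow> real \<Rightarrow> 'a \<Rightarrow> ereal" where
  "lagr f lam laminf x = f 0 x + limsup (\<lambda>n. \<Sum>k\<in>{1..n}. smul (lam k) (f k x))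
      + smul laminf (finf f x)"

definition dual_val :: "(nat \<Rightarrow> 'a \<Rightarrow> ereal) \<Rightarrow> (nat \<Rightarrow> real) \<Rightarrow> real \<Rightarrow> ereal" where
  "dual_val f lam laminf = (INF x. lagr f lam laminf x)"

definition dual_solution :: "(nat \<Rightarrow> 'a \<Rightarrow> ereal) \<Rightarrow> (nat \<Rightarrow> real) \<Rightarrow> real \<Rightarrow> bool" where
  "dual_solution f lam laminf \<longleftrightarrow> lam \<in> l1_plus \<and> 0 \<le> laminf \<and>
     dual_val f lam laminf = (SUP p\<in>{(l, li). l \<in> l1_plus \<and> 0 \<le> li}. dual_val f (fst p) (snd p))"

definition feas :: "(nat \<Rightarrow> 'a \<Rightarrow> ereal) \<Rightarrow> 'a set" where
  "feas f = edom (f 0) \<inter> {x. \<forall>k\<ge>1. f k x \<le> 0}"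

definition primal_solution :: "(nat \<Rightarrow> 'a \<Rightarrow> ereal) \<Rightarrow> 'a \<Rightarrow> bool" where
  "primal_solution f xb \<longleftrightarrow> xb \<in> feas f \<and> (\<forall>x\<in>feas f. f 0 xb \<le> f 0 x)"

definition gfam :: "(nat \<Rightarrow> 'a \<Rightarrow> ereal) \<Rightarrow> (nat \<Rightarrow> real) \<Rightarrow> real \<Rightarrow> enat \<Rightarrow> 'a \<Rightarrow> ereal" where
  "gfam f lam laminf t x =
     (if t = \<infinity> then smul laminf (finf f x)
      else if t = 0 then f 0 x
      else smul (lam (the_enat t)) (f (the_enat t) x))"

(* limsup over finite subsets of T directed by inclusion of the partial sums *)
definition sum_bar :: "('t \<Rightarrow> 'a \<Rightarrow> ereal) \<Rightarrow> 'a \<Rightarrow> ereal" where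
  "sum_bar g x = (INF S0\<in>{S. finite S}. SUP S\<in>{S. finite S \<and> S0 \<subseteq> S}. \<Sum>t\<in>S. g t x)"

definition Lambda_U :: "'a::metric_space set \<Rightarrow> ('t \<Rightarrow> 'a \<Rightarrow> ereal) \<Rightarrow> ereal" where
  "Lambda_U U g = (SUP S0\<in>{S. finite S}. INF S\<in>{S. finite S \<and> S0 \<subseteq> S}.
      Lim (at_right (0::real)) (\<lambda>\<delta>.
         INF xs\<in>{xs. (\<forall>t\<in>S. xs t \<in> U) \<and> diameter (xs ` S) < \<delta>}. \<Sum>t\<in>S. g t (xs t)))"

definition uniformly_lsc_on :: "'a::metric_space set \<Rightarrow> ('t \<Rightarrow> 'a \<Rightarrow> ereal) \<Rightarrow> bool" where
  "uniformly_lsc_on U g \<longleftrightarrow> (INF x\<in>U. sum_bar g x) \<le> Lambda_U U g"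

(* Fenchel subdifferential; ereal subtraction satisfies (+\<infinity>) - (+\<infinity>) = +\<infinity> *)
definition subdiff :: "('a::real_normed_vector \<Rightarrow> ereal) \<Rightarrow> 'a \<Rightarrow> ('a \<Rightarrow>\<^sub>L real) set" where
  "subdiff f x = {xs. \<forall>y. f y - f x \<ge> ereal (blinfun_apply xs (y - x))}"

definition normal_cone :: "'a::real_normed_vector set \<Rightarrow> 'a \<Rightarrow> ('a \<Rightarrow>\<^sub>L real) set" where
  "normal_cone A x = (if x \<in> A then {xs. \<forall>y\<in>A. blinfun_apply xs (y - x) \<le> 0} else {})"

definition scaled_subdiff :: "real \<Rightarrow> ('a::real_normed_vector \<Rightarrow> ereal) \<Rightarrow> 'a \<Rightarrow> ('a \<Rightarrow>\<^sub>L real) set" where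
  "scaled_subdiff c f x = (if c = 0 then normal_cone (edom f) x else (\<lambda>v. c *\<^sub>R v) ` subdiff f x)"

end

theory Submission
  imports Defs
begin

text \<open>
  Under Slater's condition the problem admits the exact penalty \<open>M max(0, sup f\<^sub>k)\<close>. Dominating by this
  sublinear functional in the Hahn--Banach--Lagrange theorem over the bounded sequences gives a positive
  functional, whose summable and singular parts are multipliers with dual value \<open>f\<^sub>0(xb)\<close>. Hence every
  dual solution has a Lagrangian bounded below by \<open>f\<^sub>0(xb)\<close>, and complementary slackness follows.

  Uniform lower semicontinuity turns this bound into a bound on finite decoupled sums
  \<open>\<Sum> g\<^sub>t(x\<^sub>t)\<close> at points of small diameter, so that \<open>(xb, \<dots>, xb)\<close> almost minimizes the decoupled sum
  with the penalty \<open>\<kappa> \<Sum> \<parallel>x\<^sub>t - x\<^sub>0\<parallel>\<close>. Ekeland's principle produces an exact minimizer of a small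
  perturbation, and the Hahn--Banach--Lagrange theorem separates it into subgradients whose sum only
  feels the perturbation.
\<close>

section \<open>Hahn--Banach--Lagrange theorem\<close>

text \<open>Optimality of the given dual pair says only that its value dominates that of every other
  pair, so its value is found by constructing a competitor of value at least \<open>f 0 xb\<close>.
  The dual of the bounded sequences is larger than l^1; mass that escapes to infinity acts on tails
  alone, and this forces a multiplier for the limit superior.

  No common point of continuity is available, so an exact sum rule is out of reach. After
  decoupling, each function has its own variable, and the variables are tied together only by a
  continuous penalty and a norm, which Hahn-Banach-Lagrange separates without a constraint
  qualification. The order of choices matters: the tolerance \<eta> and the radius r are fixed
  before the number n of functions, so the final bound on the sum of subgradients must be free of n,
  although the penalty constant is not.\<close>

definition sublinear :: "('a::real_vector \<Rightarrow> real) \<Rightarrow> bool" where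
  "sublinear p \<longleftrightarrow> (\<forall>x y. p (x + y) \<le> p x + p y) \<and> (\<forall>x. \<forall>t>0. p (t *\<^sub>R x) = t * p x)"

lemma sublinear_add: "sublinear p \<Longrightarrow> p (x + y) \<le> p x + p y"
  by (simp add: sublinear_def)

lemma sublinear_scaleR: "sublinear p \<Longrightarrow> 0 < t \<Longrightarrow> p (t *\<^sub>R x) = t * p x"
  by (simp add: sublinear_def)

lemma sublinear_0: "sublinear p \<Longrightarrow> p 0 = 0"
  using sublinear_scaleR[of p 2 0] by simp

lemma sublinear_scaleR_nonneg: "sublinear p \<Longrightarrow> 0 \<le> t \<Longrightarrow> p (t *\<^sub>R x) = t * p x"
  by (cases "t = 0") (auto simp: sublinear_0 sublinear_scaleR)

lemma sublinear_minus: "sublinear p \<Longrightarrow> - p (- x) \<le> p x"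
  using sublinear_add[of p x "- x"] sublinear_0[of p] by simp

lemma sublinearI:
  assumes "\<And>x y. p (x + y) \<le> p x + p y"
    and "\<And>x t. 0 < t \<Longrightarrow> p (t *\<^sub>R x) \<le> t * p x"
  shows "sublinear p"
proof -
  have "p (t *\<^sub>R x) = t * p x" if t: "0 < t" for t x
  proof (rule antisym)
    have "p ((1 / t) *\<^sub>R (t *\<^sub>R x)) \<le> (1 / t) * p (t *\<^sub>R x)"
      using t by (intro assms(2)) simp
    then show "t * p x \<le> p (t *\<^sub>R x)"
      using t by (simp add: field_simps)
  qed (rule assms(2)[OF t])
  then show ?thesis
    using assms(1) by (simp add: sublinear_def)
qed

text \<open>
  For a singleton \<open>C = {(a, - p a)}\<close> and \<open>\<beta> = 0\<close> this shows that a minimal sublinear functional is odd,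
  hence linear; for general \<open>C\<close> it reduces the Lagrange form of the Hahn--Banach theorem to the plain one.
\<close>

lemma sublinear_refine:
  fixes p :: "'e::real_vector \<Rightarrow> real" and C :: "('e \<times> real) set"
  assumes p: "sublinear p" and C: "convex C" "C \<noteq> {}"
    and bd: "\<And>a r. (a, r) \<in> C \<Longrightarrow> \<beta> \<le> p a + r"
  shows "\<exists>q. sublinear q \<and> (\<forall>x. q x \<le> p x) \<and> (\<forall>(a, r)\<in>C. q (- a) \<le> r - \<beta>)"
proof -
  define I where "I = C \<times> {0::real..}"
  \<comment> \<open>\<open>x\<close> is split as
    \<open>(x + l *\<^sub>R a) + l *\<^sub>R (- a)\<close>. The first part is charged by
    \<open>p\<close>, the second at the rate \<open>r - \<beta>\<close>, which is the bound wanted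
    at \<open>- a\<close>; \<open>q\<close> takes the cheapest splitting.\<close>
  define v where "v x = (\<lambda>((a, r), l). p (x + l *\<^sub>R a) + l * (r - \<beta>))" for x
  define q where "q x = (INF i\<in>I. v x i)" for x
  have I_ne: "I \<noteq> {}"
    using C(2) by (auto simp: I_def)
  \<comment> \<open>The hypothesis \<open>bd\<close>, scaled by \<open>l\<close>, bounds every
    splitting from below, so the infimum \<open>q x\<close> is a genuine real infimum.\<close>
  have v_ge: "- p (- x) \<le> v x i" if iI: "i \<in> I" for x i
  proof -
    obtain a r l where i: "i = ((a, r), l)" "(a, r) \<in> C" "0 \<le> l"
      using iI by (auto simp: I_def)
    have "l * p a = p (l *\<^sub>R a)"
      using p i(3) by (simp add: sublinear_scaleR_nonneg)
    also have "\<dots> \<le> p (x + l *\<^sub>R a) + p (- x)"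
      using sublinear_add[OF p, of "x + l *\<^sub>R a" "- x"] by simp
    finally have "l * (p a + r - \<beta>) \<le> v x i + p (- x)"
      by (simp add: i v_def algebra_simps)
    moreover have "0 \<le> l * (p a + r - \<beta>)"
      using bd[OF i(2)] i(3) by simp
    ultimately show ?thesis by linarith
  qed
  have bdd: "bdd_below (v x ` I)" for x
    by (rule bdd_belowI2[OF v_ge])
  have q_le: "q x \<le> v x i" if "i \<in> I" for x i
    unfolding q_def by (rule cINF_lower[OF bdd that])
  have "sublinear q"
  proof (rule sublinearI)
    fix x y
    have "q (x + y) \<le> v x i + v y j" if ij: "i \<in> I" "j \<in> I" for i j
    proof -
      obtain a r l where i: "i = ((a, r), l)" "(a, r) \<in> C" "0 \<le> l"
        using ij by (auto simp: I_def)
      obtain b s m where j: "j = ((b, s), m)" "(b, s) \<in> C" "0 \<le> m"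
        using ij by (auto simp: I_def)
      show ?thesis
      proof (cases "l + m = 0")
        case True
        then have "l = 0" "m = 0" using i j by auto
        have "q (x + y) \<le> v (x + y) i"
          using ij by (intro q_le)
        also have "\<dots> \<le> v x i + v y j"
          using sublinear_add[OF p, of x y] by (simp add: i j v_def \<open>l = 0\<close> \<open>m = 0\<close>)
        finally show ?thesis .
      next
        case False
        then have lm: "0 < l + m" using i j by simp
        \<comment> \<open>Two splittings merge into one of total weight \<open>l + m\<close> at the
          weighted mean of the two points of \<open>C\<close>; this is where convexity of
          \<open>C\<close> enters.\<close>
        define c where "c = (l / (l + m)) *\<^sub>R (a, r) + (m / (l + m)) *\<^sub>R (b, s)"
        have "c \<in> C"
          unfolding c_def using C(1) i j lm
          by (intro convexD) (auto simp: add_divide_distrib[symmetric])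
        then have cI: "(c, l + m) \<in> I"
          using lm by (simp add: I_def)
        have fs: "(l + m) *\<^sub>R fst c = l *\<^sub>R a + m *\<^sub>R b"
          using lm by (simp add: c_def scaleR_add_right)
        have sn: "(l + m) * snd c = l * r + m * s"
          using lm by (simp add: c_def distrib_left)
        have "q (x + y) \<le> v (x + y) (c, l + m)"
          by (rule q_le[OF cI])
        also have "\<dots> = p ((x + l *\<^sub>R a) + (y + m *\<^sub>R b)) + (l * r + m * s - (l + m) * \<beta>)"
          using fs sn by (simp add: v_def case_prod_beta algebra_simps)
        also have "\<dots> \<le> v x i + v y j"
          using sublinear_add[OF p, of "x + l *\<^sub>R a" "y + m *\<^sub>R b"]
          by (simp add: v_def i j algebra_simps)
        finally show ?thesis .
      qed
    qed
    then have "q (x + y) - v x i \<le> q y" if "i \<in> I" for i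
      unfolding q_def[of y] using that I_ne
      by (intro cINF_greatest) (auto simp: algebra_simps)
    then have "q (x + y) - q y \<le> q x"
      unfolding q_def[of x] using I_ne
      by (intro cINF_greatest) (auto simp: algebra_simps)
    then show "q (x + y) \<le> q x + q y" by simp
  next
    fix x and t :: real assume t: "0 < t"
    have "q (t *\<^sub>R x) / t \<le> v x i" if "i \<in> I" for i
    proof -
      obtain a r l where i: "i = ((a, r), l)" "(a, r) \<in> C" "0 \<le> l"
        using \<open>i \<in> I\<close> by (auto simp: I_def)
      have "q (t *\<^sub>R x) \<le> v (t *\<^sub>R x) ((a, r), t * l)"
        using i t by (intro q_le) (simp add: I_def)
      also have "\<dots> = p (t *\<^sub>R (x + l *\<^sub>R a)) + t * (l * (r - \<beta>))"
        by (simp add: v_def algebra_simps)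
      also have "\<dots> = t * v x i"
        unfolding sublinear_scaleR[OF p t] by (simp add: v_def i distrib_left)
      finally show ?thesis using t by (simp add: field_simps)
    qed
    then have "q (t *\<^sub>R x) / t \<le> q x"
      unfolding q_def[of x] by (intro cINF_greatest I_ne)
    then show "q (t *\<^sub>R x) \<le> t * q x"
      using t by (simp add: field_simps)
  qed
  moreover have "q x \<le> p x" for x
  proof -
    obtain c where "c \<in> C" using C(2) by auto
    then have "q x \<le> v x (c, 0)"
      by (intro q_le) (simp add: I_def)
    then show ?thesis by (simp add: v_def case_prod_beta)
  qed
  \<comment> \<open>With \<open>l = 1\<close> the splitting of \<open>- a\<close> leaves
    \<open>p 0 = 0\<close> and the charge \<open>r - \<beta>\<close>.\<close>
  moreover have "q (- a) \<le> r - \<beta>" if "(a, r) \<in> C" for a r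
    using q_le[of "((a, r), 1)" "- a"] that sublinear_0[OF p] by (simp add: I_def v_def)
  ultimately show ?thesis by blast
qed

text \<open>Provides the bound of a chain for Zorn's lemma. The values at x stay above - p (- x), so
  the infimum is finite; for subadditivity, the smaller of two comparable members replaces
  both.\<close>

lemma sublinear_chain_Inf:
  fixes Q :: "('e::real_vector \<Rightarrow> real) set"
  assumes sub: "\<And>q. q \<in> Q \<Longrightarrow> sublinear q" and ne: "Q \<noteq> {}"
    and le: "\<And>q x. q \<in> Q \<Longrightarrow> q x \<le> p x"
    and chain: "\<And>q r. q \<in> Q \<Longrightarrow> r \<in> Q \<Longrightarrow> (\<forall>x. q x \<le> r x) \<or> (\<forall>x. r x \<le> q x)"
  shows "sublinear (\<lambda>x. INF q\<in>Q. q x)" and "\<And>q x. q \<in> Q \<Longrightarrow> (INF q\<in>Q. q x) \<le> q x"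
proof -
  have "- p (- x) \<le> q x" if "q \<in> Q" for q x
    using sublinear_minus[OF sub[OF that], of x] le[OF that, of "- x"] by linarith
  then have bdd: "bdd_below ((\<lambda>q. q x) ` Q)" for x
    by (auto simp: bdd_below_def)
  show lower: "(INF q\<in>Q. q x) \<le> q x" if "q \<in> Q" for q x
    by (rule cINF_lower[OF bdd that])
  show "sublinear (\<lambda>x. INF q\<in>Q. q x)"
  proof (rule sublinearI)
    fix x y
    have key: "(INF q\<in>Q. q (x + y)) \<le> q x + r y" if qr: "q \<in> Q" "r \<in> Q" for q r
    proof -
      obtain s where s: "s \<in> Q" "\<forall>x. s x \<le> q x" "\<forall>x. s x \<le> r x"
        using chain[OF qr] qr by (meson order_refl)
      have "(INF q\<in>Q. q (x + y)) \<le> s (x + y)"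
        by (rule lower[OF s(1)])
      also have "\<dots> \<le> s x + s y"
        by (rule sublinear_add[OF sub[OF s(1)]])
      finally show ?thesis
        using s(2,3) by (meson add_mono order_trans)
    qed
    have "(INF q\<in>Q. q (x + y)) - q x \<le> (INF r\<in>Q. r y)" if "q \<in> Q" for q
      using key[OF that] ne by (intro cINF_greatest) (auto simp: algebra_simps)
    then have "(INF q\<in>Q. q (x + y)) - (INF r\<in>Q. r y) \<le> (INF q\<in>Q. q x)"
      using ne by (intro cINF_greatest) (auto simp: algebra_simps)
    then show "(INF q\<in>Q. q (x + y)) \<le> (INF q\<in>Q. q x) + (INF q\<in>Q. q y)" by simp
  next
    fix x and t :: real assume t: "0 < t"
    have "(INF q\<in>Q. q (t *\<^sub>R x)) / t \<le> q x" if "q \<in> Q" for q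
      using lower[OF that, of "t *\<^sub>R x"] t sublinear_scaleR[OF sub[OF that] t, of x]
      by (simp add: field_simps)
    then have "(INF q\<in>Q. q (t *\<^sub>R x)) / t \<le> (INF q\<in>Q. q x)"
      using ne by (intro cINF_greatest)
    then show "(INF q\<in>Q. q (t *\<^sub>R x)) \<le> t * (INF q\<in>Q. q x)"
      using t by (simp add: field_simps)
  qed
qed

theorem Hahn_Banach_sublinear:
  fixes p :: "'e::real_vector \<Rightarrow> real"
  assumes p: "sublinear p"
  shows "\<exists>L. linear L \<and> (\<forall>x. L x \<le> p x)"
proof -
  define A where "A = {q. sublinear q \<and> (\<forall>x. q x \<le> p x)}"
  \<comment> \<open>The order is reversed, so that the maximal element from Zorn's lemma is a
    minimal sublinear functional.\<close>
  define P where "P q r \<longleftrightarrow> (\<forall>x. r x \<le> q x)" for q r :: "'e \<Rightarrow> real"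
  have "\<exists>m\<in>A. \<forall>a\<in>A. P m a \<longrightarrow> a = m"
  proof (rule predicate_Zorn)
    show "partial_order_on A (relation_of P A)"
      by (rule partial_order_on_relation_ofI)
        (auto simp: P_def fun_eq_iff intro: order_trans antisym)
  next
    fix Q assume Q: "Q \<in> Chains (relation_of P A)"
    show "\<exists>u\<in>A. \<forall>a\<in>Q. P a u"
    proof (cases "Q = {}")
      case True
      then show ?thesis using p by (auto simp: A_def)
    next
      case False
      have mem: "sublinear q" "q x \<le> p x" if "q \<in> Q" for q x
        using Q that by (auto simp: Chains_def relation_of_def A_def)
      have chain: "(\<forall>x. q x \<le> r x) \<or> (\<forall>x. r x \<le> q x)" if "q \<in> Q" "r \<in> Q" for q r
        using Q that by (auto simp: Chains_def relation_of_def P_def)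
      have Inf: "sublinear (\<lambda>x. INF q\<in>Q. q x)" "\<And>q x. q \<in> Q \<Longrightarrow> (INF q\<in>Q. q x) \<le> q x"
        using sublinear_chain_Inf[of Q p] mem False chain by blast+
      have "(INF q\<in>Q. q x) \<le> p x" for x
        using False Inf(2) mem(2) by (meson ex_in_conv order_trans)
      then have "(\<lambda>x. INF q\<in>Q. q x) \<in> A"
        using Inf(1) by (simp add: A_def)
      then show ?thesis
        using Inf(2) by (intro bexI[of _ "\<lambda>x. INF q\<in>Q. q x"]) (auto simp: P_def)
    qed
  qed
  then obtain m where m: "m \<in> A" "\<And>a. a \<in> A \<Longrightarrow> \<forall>x. a x \<le> m x \<Longrightarrow> a = m"
    by (auto simp: P_def)
  then have sub: "sublinear m" and le: "\<And>x. m x \<le> p x"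
    by (auto simp: A_def)
  have odd: "m (- a) = - m a" for a
  proof -
    have "\<exists>q. sublinear q \<and> (\<forall>x. q x \<le> m x) \<and> (\<forall>(a, r)\<in>{(a, - m a)}. q (- a) \<le> r - 0)"
      by (rule sublinear_refine[OF sub]) auto
    then obtain q where q: "sublinear q" "\<forall>x. q x \<le> m x" "q (- a) \<le> - m a"
      by auto
    then have "q \<in> A" using le by (auto simp: A_def intro: order_trans)
    then have "q = m" using q(2) by (rule m(2))
    then show ?thesis
      using q(3) sublinear_minus[OF sub, of a] by simp
  qed
  have "linear m"
  proof (rule linearI)
    fix x y
    show "m (x + y) = m x + m y"
      using sublinear_add[OF sub, of x y] sublinear_add[OF sub, of "x + y" "- y"] odd[of y]
      by simp
  next
    fix t :: real and x
    show "m (t *\<^sub>R x) = t *\<^sub>R m x"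
    proof (cases "0 \<le> t")
      case False
      then have "m ((- t) *\<^sub>R x) = (- t) * m x"
        by (intro sublinear_scaleR[OF sub]) simp
      then show ?thesis using odd[of "t *\<^sub>R x"] by simp
    qed (simp add: sublinear_scaleR_nonneg[OF sub])
  qed
  then show ?thesis using le by blast
qed

theorem Hahn_Banach_Lagrange:
  fixes p :: "'e::real_vector \<Rightarrow> real" and C :: "('e \<times> real) set"
  assumes "sublinear p" "convex C" "C \<noteq> {}"
    and "\<And>a r. (a, r) \<in> C \<Longrightarrow> \<beta> \<le> p a + r"
  shows "\<exists>L. linear L \<and> (\<forall>x. L x \<le> p x) \<and> (\<forall>(a, r)\<in>C. \<beta> \<le> L a + r)"
proof -
  obtain q where q: "sublinear q" "\<And>x. q x \<le> p x" "\<And>a r. (a, r) \<in> C \<Longrightarrow> q (- a) \<le> r - \<beta>"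
    using sublinear_refine[OF assms] by fast
  obtain L where L: "linear L" "\<And>x. L x \<le> q x"
    using Hahn_Banach_sublinear[OF q(1)] by blast
  \<comment> \<open>Linearity turns the upper bound of \<open>q\<close> at \<open>- a\<close> into a
    lower bound of \<open>L\<close> at \<open>a\<close>.\<close>
  have "\<beta> \<le> L a + r" if "(a, r) \<in> C" for a r
    using q(3)[OF that] L(2)[of "- a"] linear_neg[OF L(1), of a] by simp
  then show ?thesis
    using L(1) order_trans[OF L(2) q(2)] by (intro exI[of _ L]) auto
qed

section \<open>Ekeland's variational principle\<close>

text \<open>Completeness is asked of the sublevel sets because the intended \<open>K\<close>
  consists of points of finite value and need not be closed. This one hypothesis carries both lower
  semicontinuity and completeness of the space.\<close>

theorem Ekeland_variational_principle:
  fixes K :: "'b::metric_space set" and \<phi> :: "'b \<Rightarrow> real"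
  assumes complete_sub: "\<And>\<alpha>. complete {z\<in>K. \<phi> z \<le> \<alpha>}"
    and lower: "\<And>z. z \<in> K \<Longrightarrow> b \<le> \<phi> z"
    and x0: "x0 \<in> K" and c: "0 < c"
  shows "\<exists>y\<in>K. \<phi> y + c * dist x0 y \<le> \<phi> x0 \<and> (\<forall>z\<in>K. \<phi> y \<le> \<phi> z + c * dist z y)"
proof -
  \<comment> \<open>\<open>S x\<close> is the set of points below \<open>x\<close> in the
    Bishop-Phelps order; the triangle inequality gives transitivity.\<close>
  define S where "S x = {z\<in>K. \<phi> z + c * dist x z \<le> \<phi> x}" for x
  have S_self: "x \<in> S x" if "x \<in> K" for x
    using that by (simp add: S_def)
  have S_trans: "S y \<subseteq> S x" if "y \<in> S x" for x y
  proof
    fix z assume z: "z \<in> S y"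
    have "c * dist x z \<le> c * dist x y + c * dist y z"
      using dist_triangle[of x z y] c by (simp flip: distrib_left)
    then show "z \<in> S x" using z that by (auto simp: S_def)
  qed
  have S_closed: "closed (S x)" for x
    unfolding closed_sequential_limits
  proof (intro allI impI, elim conjE)
    fix u l assume u: "\<forall>n. u n \<in> S x" and lim: "u \<longlonglongrightarrow> l"
    have u_mem: "u n \<in> K" "\<phi> (u n) \<le> \<phi> x - c * dist x (u n)" for n
      using u[rule_format, of n] by (auto simp: S_def)
    \<comment> \<open>The bound on \<open>\<phi> (u n)\<close> varies with n. With slack
      \<open>e\<close> a tail of the sequence lies in one fixed sublevel set, which is closed; then
      \<open>e\<close> tends to 0.\<close>
    have le: "l \<in> K \<and> \<phi> l \<le> \<phi> x - c * dist x l + e" if "0 < e" for e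
    proof -
      have "(\<lambda>n. \<phi> x - c * dist x (u n)) \<longlonglongrightarrow> \<phi> x - c * dist x l"
        by (intro tendsto_intros lim)
      then have "\<forall>\<^sub>F n in sequentially. \<phi> x - c * dist x (u n) < \<phi> x - c * dist x l + e"
        using that by (intro order_tendstoD) auto
      then have "\<forall>\<^sub>F n in sequentially. u n \<in> {z\<in>K. \<phi> z \<le> \<phi> x - c * dist x l + e}"
      proof eventually_elim
        case (elim n)
        then show ?case using u_mem[of n] by simp
      qed
      then have "l \<in> {z\<in>K. \<phi> z \<le> \<phi> x - c * dist x l + e}"
        by (intro Lim_in_closed_set[OF complete_imp_closed[OF complete_sub] _ _ lim]) auto
      then show ?thesis by simp
    qed
    then have "\<phi> l \<le> \<phi> x - c * dist x l"
      using field_le_epsilon by blast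
    then show "l \<in> S x"
      using le[of 1] by (simp add: S_def)
  qed
  have "\<exists>y. y \<in> S x \<and> (\<forall>z\<in>S x. \<phi> y \<le> \<phi> z + (1/2)^n)" if "x \<in> K" for x and n :: nat
  proof -
    have bdd: "bdd_below (\<phi> ` S x)"
      using lower by (auto simp: bdd_below_def S_def)
    have ne: "S x \<noteq> {}" using S_self[OF that] by auto
    have "(INF z\<in>S x. \<phi> z) < (INF z\<in>S x. \<phi> z) + (1/2)^n" by simp
    then obtain y where y: "y \<in> S x" "\<phi> y < (INF z\<in>S x. \<phi> z) + (1/2)^n"
      using cINF_less_iff[OF ne bdd] by blast
    then show ?thesis
      using cINF_lower[OF bdd] by (intro exI[of _ y]) (smt (verit, best))
  qed
  then have "\<forall>n x. \<exists>y. x \<in> K \<longrightarrow> y \<in> S x \<and> (\<forall>z\<in>S x. \<phi> y \<le> \<phi> z + (1/2)^n)"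
    by blast
  then obtain N where "\<forall>n x. x \<in> K \<longrightarrow> N n x \<in> S x \<and> (\<forall>z\<in>S x. \<phi> (N n x) \<le> \<phi> z + (1/2)^n)"
    by metis
  then have N: "\<And>x n. x \<in> K \<Longrightarrow> N n x \<in> S x"
      "\<And>x n z. x \<in> K \<Longrightarrow> z \<in> S x \<Longrightarrow> \<phi> (N n x) \<le> \<phi> z + (1/2)^n"
    by blast+
  \<comment> \<open>Each new point minimizes \<phi> over \<open>S (u n)\<close> up to
    \<open>(1/2)^n\<close>. Distances are controlled by the decrease of \<phi>, which makes the
    sequence Cauchy.\<close>
  define u where "u = rec_nat x0 N"
  have u_simps: "u 0 = x0" "\<And>n. u (Suc n) = N n (u n)"
    by (simp_all add: u_def)
  have uK: "u n \<in> K" for n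
    by (induction n) (use N(1) x0 in \<open>auto simp: u_simps S_def\<close>)
  have u_mem: "u m \<in> S (u n)" if "n \<le> m" for n m
    using that
  proof (induction m rule: dec_induct)
    case base
    show ?case by (rule S_self[OF uK])
  next
    case (step m)
    then show ?case using N(1)[OF uK, of m m] S_trans by (auto simp: u_simps)
  qed
  have dec: "decseq (\<lambda>n. \<phi> (u n))"
    unfolding decseq_def using u_mem c
    by (auto simp: S_def) (smt (verit, best) mult_nonneg_nonneg zero_le_dist)
  have "bdd_below (range (\<lambda>n. \<phi> (u n)))"
    using lower uK by (auto simp: bdd_below_def)
  then have "convergent (\<lambda>n. \<phi> (u n))"
    using LIMSEQ_decseq_INF dec convergentI by blast
  then have Cau: "Cauchy (\<lambda>n. \<phi> (u n))"
    by (rule convergent_Cauchy)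
  have "Cauchy u"
  proof (rule metric_CauchyI)
    fix e :: real assume "0 < e"
    then obtain M where M: "\<And>m n. M \<le> m \<Longrightarrow> M \<le> n \<Longrightarrow> dist (\<phi> (u m)) (\<phi> (u n)) < c * e"
      using Cau c unfolding Cauchy_def by (meson mult_pos_pos)
    have *: "dist (u m) (u n) < e" if "M \<le> m" "m \<le> n" for m n
    proof -
      have "c * dist (u m) (u n) \<le> \<phi> (u m) - \<phi> (u n)"
        using u_mem[OF that(2)] by (simp add: S_def)
      also have "\<dots> < c * e"
        using M[of m n] that by (simp add: dist_real_def)
      finally show ?thesis using c by simp
    qed
    then have "dist (u m) (u n) < e" if "M \<le> m" "M \<le> n" for m n
      using that by (metis dist_commute nat_le_linear)
    then show "\<exists>M. \<forall>m\<ge>M. \<forall>n\<ge>M. dist (u m) (u n) < e" by blast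
  qed
  moreover have "u n \<in> {z\<in>K. \<phi> z \<le> \<phi> (u 0)}" for n
    using uK decseqD[OF dec, of 0 n] by simp
  ultimately obtain y where lim: "u \<longlonglongrightarrow> y"
    using complete_sub[of "\<phi> (u 0)"] unfolding complete_def by blast
  have y_mem: "y \<in> S (u n)" for n
  proof (rule Lim_in_closed_set[OF S_closed _ _ lim])
    show "\<forall>\<^sub>F m in sequentially. u m \<in> S (u n)"
      using eventually_ge_at_top[of n] by eventually_elim (rule u_mem)
  qed auto
  have min: "\<phi> y \<le> \<phi> z + c * dist z y" if z: "z \<in> K" for z
  proof (rule ccontr)
    assume "\<not> ?thesis"
    then have less: "\<phi> z + c * dist y z < \<phi> y" by (simp add: dist_commute)
    then have "z \<in> S y" using z by (simp add: S_def)
    \<comment> \<open>A strictly better point \<open>z\<close> would lie in every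
      \<open>S (u n)\<close>, and the vanishing tolerances would then force
      \<open>\<phi> y \<le> \<phi> z\<close>.\<close>
    then have zS: "z \<in> S (u n)" for n using S_trans[OF y_mem] by blast
    have "\<phi> y \<le> \<phi> z + (1/2)^n" for n
    proof -
      have "\<phi> y \<le> \<phi> (u (Suc n))"
        using y_mem[of "Suc n"] c by (auto simp: S_def) (smt (verit, best) mult_nonneg_nonneg zero_le_dist)
      also have "\<dots> \<le> \<phi> z + (1/2)^n"
        using N(2)[OF uK zS, of n] by (simp add: u_simps)
      finally show ?thesis .
    qed
    moreover have "(\<lambda>n. \<phi> z + (1/2)^n) \<longlonglongrightarrow> \<phi> z + 0"
      by (intro tendsto_intros LIMSEQ_power_zero) auto
    ultimately have "\<phi> y \<le> \<phi> z + 0"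
      by (intro LIMSEQ_le_const) auto
    moreover have "0 \<le> c * dist y z" using c by simp
    ultimately show False using less by linarith
  qed
  show ?thesis
    using y_mem[of 0] min by (intro bexI[of _ y]) (auto simp: S_def u_simps)
qed

section \<open>Strong duality for countably many constraints\<close>

text \<open>Real upper bounds, that is, points of the epigraph, keep +\<infinity> out of convex
  combinations and admit the weights 0 and 1.\<close>

lemma convex_efun_le:
  assumes "convex_efun g" "g x \<le> ereal a" "g y \<le> ereal b" "0 \<le> u" "0 \<le> w" "u + w = 1"
  shows "g (u *\<^sub>R x + w *\<^sub>R y) \<le> ereal (u * a + w * b)"
proof (cases "u = 0 \<or> w = 0")
  case True
  then show ?thesis using assms by auto
next
  case False
  then have w: "0 < w" "w < 1" and u: "u = 1 - w" using assms by auto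
  then have "g (u *\<^sub>R x + w *\<^sub>R y) \<le> ereal (1 - w) * g x + ereal w * g y"
    using assms(1) by (simp add: convex_efun_def)
  also have "\<dots> \<le> ereal (1 - w) * ereal a + ereal w * ereal b"
    using assms w by (intro add_mono ereal_mult_left_mono) auto
  finally show ?thesis by (simp add: u)
qed

lemma apply_bcontfun_sum: "apply_bcontfun (\<Sum>i\<in>A. F i) x = (\<Sum>i\<in>A. apply_bcontfun (F i) x)"
  by (induction A rule: infinite_finite_induct) auto

text \<open>Continuity is automatic on a discrete index type, so the bounded continuous functions on
  the naturals serve as the space of bounded sequences.\<close>

lemma apply_Bcontfun_discrete:
  fixes h :: "'i::discrete_topology \<Rightarrow> 'b::metric_space"
  assumes "bounded (range h)"
  shows "apply_bcontfun (Bcontfun h) = h"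
  using assms by (intro Bcontfun_inverse) (simp add: bcontfun_def continuous_on_discrete)

text \<open>
  A positive functional on bounded sequences splits into a summable part and a singular part; the latter
  is dominated by a multiple of the limit superior, which is the origin of the multiplier of \<open>f\<^sub>\<infinity>\<close>.
\<close>

lemma positive_functional_le_series_limsup:
  fixes L :: "(nat \<Rightarrow>\<^sub>C real) \<Rightarrow> real"
  assumes L: "linear L" and neg: "\<And>a. (\<And>k. apply_bcontfun a k \<le> 0) \<Longrightarrow> L a \<le> 0"
  shows "\<exists>lam li. (\<forall>k. 0 \<le> lam k) \<and> summable lam \<and> 0 \<le> li \<and>
    (\<forall>a s. (\<forall>\<^sub>F k in sequentially. apply_bcontfun a k \<le> s) \<longrightarrow>
      summable (\<lambda>k. lam k * apply_bcontfun a k) \<and> L a \<le> (\<Sum>k. lam k * apply_bcontfun a k) + li * s)"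
proof -
  define e :: "nat \<Rightarrow> nat \<Rightarrow>\<^sub>C real" where "e k = Bcontfun (\<lambda>i. if i = k then 1 else 0)" for k
  define one :: "nat \<Rightarrow>\<^sub>C real" where "one = const_bcontfun 1"
  define lam where "lam k = L (e k)" for k
  have e: "apply_bcontfun (e k) i = (if i = k then 1 else 0)" for k i
    unfolding e_def by (subst apply_Bcontfun_discrete) (auto intro!: boundedI[of _ 1])
  have lin: "L (\<Sum>k<m. c k *\<^sub>R e k) = (\<Sum>k<m. lam k * c k)" for c and m :: nat
    by (simp add: lam_def linear_sum[OF L] linear_scale[OF L] mult.commute)
  have val: "apply_bcontfun (\<Sum>k<m. c k *\<^sub>R e k) i = (if i < m then c i else 0)" for c and m i :: nat
    by (simp add: apply_bcontfun_sum e if_distrib cong: if_cong)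
  have lam_nonneg: "0 \<le> lam k" for k
    using neg[of "- e k"] by (simp add: lam_def e linear_neg[OF L])
  \<comment> \<open>Finite sums of unit sequences lie below the constant sequence 1, and
    \<open>L\<close> is monotone.\<close>
  have part: "(\<Sum>k<m. lam k) \<le> L one" for m
    using neg[of "(\<Sum>k<m. 1 *\<^sub>R e k) - one"] lin[of "\<lambda>_. 1" m]
    by (simp add: val one_def linear_diff[OF L] del: scaleR_one)
  have sm: "summable lam"
    by (rule summableI_nonneg_bounded[OF lam_nonneg part])
  have sm_a: "summable (\<lambda>k. lam k * apply_bcontfun a k)" for a
  proof (rule summable_comparison_test')
    show "summable (\<lambda>k. lam k * norm a)" by (rule summable_mult2[OF sm])
    show "norm (lam k * apply_bcontfun a k) \<le> lam k * norm a" for k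
      using lam_nonneg[of k] norm_bounded[of a k] by (simp add: abs_mult mult_left_mono)
  qed
  \<comment> \<open>\<open>L one - suminf lam\<close> is the mass that \<open>L\<close> puts at
    infinity.\<close>
  have "L a \<le> (\<Sum>k. lam k * apply_bcontfun a k) + (L one - suminf lam) * s"
    if ev: "\<forall>\<^sub>F k in sequentially. apply_bcontfun a k \<le> s" for a s
  proof -
    obtain n where n: "\<And>k. n \<le> k \<Longrightarrow> apply_bcontfun a k \<le> s"
      using ev by (auto simp: eventually_sequentially)
    have "L a \<le> (\<Sum>k<m. lam k * (apply_bcontfun a k - s)) + s * L one" if "n \<le> m" for m
    proof -
      \<comment> \<open>The argument of \<open>L\<close> is 0 at the first m indices and
        \<open>a k - s\<close> beyond them, hence nonpositive.\<close>
      have "L (a - (\<Sum>k<m. (apply_bcontfun a k - s) *\<^sub>R e k) - s *\<^sub>R one) \<le> 0"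
        using n that by (intro neg) (simp add: val one_def del: scaleR_conv_of_real)
      then show ?thesis
        by (simp add: linear_diff[OF L] linear_scale[OF L] lin)
    qed
    moreover have "(\<lambda>m. (\<Sum>k<m. lam k * (apply_bcontfun a k - s)) + s * L one)
        \<longlonglongrightarrow> (\<Sum>k. lam k * (apply_bcontfun a k - s)) + s * L one"
      using summable_diff[OF sm_a summable_mult2[OF sm]]
      by (intro tendsto_intros summable_LIMSEQ) (simp add: right_diff_distrib)
    ultimately have "L a \<le> (\<Sum>k. lam k * (apply_bcontfun a k - s)) + s * L one"
      by (intro LIMSEQ_le_const) auto
    also have "(\<Sum>k. lam k * (apply_bcontfun a k - s)) = (\<Sum>k. lam k * apply_bcontfun a k) - suminf lam * s"
      using suminf_diff[OF sm_a summable_mult2[OF sm]] suminf_mult2[OF sm, of s]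
      by (simp add: right_diff_distrib)
    finally show ?thesis by (simp add: algebra_simps)
  qed
  moreover have "0 \<le> L one - suminf lam"
    using suminf_le_const[OF sm part] by simp
  ultimately show ?thesis
    using lam_nonneg sm sm_a by (intro exI[of _ lam] exI[of _ "L one - suminf lam"]) auto
qed

text \<open>Mixing \<open>x\<close> with the Slater point in weights that balance the violation
  \<open>s\<close> against the slack \<eta> gives a feasible point. Comparing its value with
  \<open>v\<close> and clearing the denominator produces the penalty constant.\<close>

lemma slater_exact_penalty:
  fixes h :: "'i \<Rightarrow> 'a::real_vector \<Rightarrow> ereal"
  assumes conv0: "convex_efun f0" and conv: "\<And>k. convex_efun (h k)"
    and slater: "f0 x' \<le> ereal r'" "\<And>k. h k x' \<le> ereal (- \<eta>)" "0 < \<eta>"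
    and opt: "\<And>x. (\<And>k. h k x \<le> 0) \<Longrightarrow> ereal v \<le> f0 x"
    and x: "f0 x \<le> ereal r" "\<And>k. h k x \<le> ereal s" "0 \<le> s"
  shows "v \<le> (r' - v) / \<eta> * s + r"
proof -
  define u w where "u = \<eta> / (\<eta> + s)" and "w = s / (\<eta> + s)"
  have pos: "0 < \<eta> + s" using slater x by simp
  have uw: "0 \<le> u" "0 \<le> w" "u + w = 1"
    using slater x pos by (auto simp: u_def w_def add_divide_distrib[symmetric])
  define z where "z = u *\<^sub>R x + w *\<^sub>R x'"
  have "h k z \<le> ereal (u * s + w * (- \<eta>))" for k
    unfolding z_def by (intro convex_efun_le conv x slater uw)
  moreover have "u * s + w * (- \<eta>) = 0"
    by (simp add: u_def w_def)
  ultimately have "ereal v \<le> f0 z"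
    by (intro opt) (simp add: zero_ereal_def)
  also have "\<dots> \<le> ereal (u * r + w * r')"
    unfolding z_def by (intro convex_efun_le conv0 x slater uw)
  finally have "v \<le> (\<eta> * r + s * r') / (\<eta> + s)"
    by (simp add: u_def w_def add_divide_distrib)
  then have "v * (\<eta> + s) \<le> \<eta> * r + s * r'"
    using pos by (simp add: pos_le_divide_eq)
  then show ?thesis
    using slater(3) by (simp add: field_simps)
qed

section \<open>Extended-real sums and one-sided bounds\<close>

lemma smul_infty [simp]: "0 \<le> c \<Longrightarrow> smul c \<infinity> = \<infinity>"
  by (simp add: smul_def)

lemma smul_ereal [simp]: "smul c (ereal r) = ereal (c * r)"
  by (simp add: smul_def)

lemma sum_ereal_not_MInf:
  fixes F :: "'i \<Rightarrow> ereal"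
  assumes "\<And>i. i \<in> A \<Longrightarrow> F i \<noteq> - \<infinity>"
  shows "(\<Sum>i\<in>A. F i) \<noteq> - \<infinity>"
  using assms by (induction A rule: infinite_finite_induct) auto

lemma sum_ereal_PInf:
  fixes F :: "'i \<Rightarrow> ereal"
  assumes "finite A" "i \<in> A" "F i = \<infinity>"
  shows "(\<Sum>i\<in>A. F i) = \<infinity>"
  using assms by (auto simp: sum_Pinfty)

text \<open>The limit superior controls a tail, and only finitely many finite values remain. The
  common bound later makes differences \<open>B - y k\<close> nonnegative and bounds partial sums of
  weighted series.\<close>

lemma bounded_above_of_limsup:
  fixes y :: "nat \<Rightarrow> ereal"
  assumes "limsup y < \<infinity>" "\<And>k. y k < \<infinity>"
  obtains B :: real where "0 \<le> B" "\<And>k. y k \<le> ereal B"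
proof -
  obtain c :: real where "limsup y < ereal c"
    using assms(1) ereal_dense2 by blast
  then have "\<forall>\<^sub>F k in sequentially. y k < ereal c"
    by (rule Limsup_lessD)
  then obtain n where n: "\<And>k. n \<le> k \<Longrightarrow> y k < ereal c"
    by (auto simp: eventually_sequentially)
  define B where "B = max c 0 + (\<Sum>k<n. \<bar>real_of_ereal (y k)\<bar>)"
  show ?thesis
  proof
    show "0 \<le> B" by (auto simp: B_def intro!: add_nonneg_nonneg sum_nonneg real_of_ereal_pos)
    show "y k \<le> ereal B" for k
    proof (cases "n \<le> k")
      case True
      have "c \<le> B" by (auto simp: B_def intro!: add_increasing2 sum_nonneg real_of_ereal_pos)
      then show ?thesis using n[OF True] by (meson ereal_less_eq(3) less_imp_le order_trans)
    next
      case False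
      have "real_of_ereal (y k) \<le> \<bar>real_of_ereal (y k)\<bar>" by (rule abs_ge_self)
      also have "\<dots> \<le> (\<Sum>k<n. \<bar>real_of_ereal (y k)\<bar>)"
        using False by (intro member_le_sum) (auto intro: real_of_ereal_pos)
      also have "\<dots> \<le> B" by (simp add: B_def)
      finally show ?thesis using assms(2)[of k] by (cases "y k") auto
    qed
  qed
qed

theorem countable_strong_duality:
  fixes h :: "nat \<Rightarrow> 'a::real_vector \<Rightarrow> ereal"
  assumes conv0: "convex_efun f0" and conv: "\<And>k. convex_efun (h k)"
    and proper0: "\<And>x. f0 x \<noteq> - \<infinity>" and proper: "\<And>k x. h k x \<noteq> - \<infinity>"
    and slater: "f0 x' < \<infinity>" "(SUP k. h k x') < 0"
    and opt: "\<And>x. (\<And>k. h k x \<le> 0) \<Longrightarrow> ereal v \<le> f0 x"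
  shows "\<exists>lam li. (\<forall>k. 0 \<le> lam k) \<and> summable lam \<and> 0 \<le> li \<and>
    (\<forall>x. ereal v \<le> f0 x + limsup (\<lambda>n. \<Sum>k<n. smul (lam k) (h k x)) + smul li (limsup (\<lambda>k. h k x)))"
proof -
  obtain r' where r': "f0 x' = ereal r'"
    using slater(1) proper0[of x'] by (cases "f0 x'") auto
  obtain d :: real where d: "(SUP k. h k x') < ereal d" "ereal d < 0"
    using ereal_dense2[OF slater(2)] by blast
  define \<eta> where "\<eta> = - d"
  have \<eta>: "0 < \<eta>" using d by (simp add: \<eta>_def)
  have h': "h k x' \<le> ereal (- \<eta>)" for k
    using d(1) by (simp add: \<eta>_def) (meson SUP_upper UNIV_I less_imp_le order_trans)
  \<comment> \<open>The constant from \<open>slater_exact_penalty\<close>; it is nonnegative because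
    the Slater point is feasible.\<close>
  define M where "M = (r' - v) / \<eta>"
  have "h k x' \<le> 0" for k
    by (rule order_trans[OF h']) (simp add: \<eta> less_imp_le)
  then have "ereal v \<le> f0 x'" by (rule opt)
  then have M: "0 \<le> M" using \<eta> by (simp add: M_def r')
  define S where "S a = (SUP k. max 0 (apply_bcontfun a k))" for a :: "nat \<Rightarrow>\<^sub>C real"
  have bdd: "bdd_above (range (\<lambda>k. max 0 (apply_bcontfun a k)))" for a :: "nat \<Rightarrow>\<^sub>C real"
  proof (rule bdd_aboveI2)
    show "max 0 (apply_bcontfun a k) \<le> norm a" for k
      using norm_bounded[of a k] by auto
  qed
  have S_upper: "max 0 (apply_bcontfun a k) \<le> S a" for a k
    unfolding S_def by (intro cSUP_upper bdd) auto
  have S_least: "S a \<le> c" if "\<And>k. apply_bcontfun a k \<le> c" "0 \<le> c" for a c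
    unfolding S_def using that by (intro cSUP_least) auto
  have S_nonneg: "0 \<le> S a" for a
    using S_upper[of a 0] by simp
  have S_ge: "apply_bcontfun a k \<le> S a" for a k
    using S_upper[of a k] by simp
  define p where "p a = M * S a" for a
  have p: "sublinear p"
  proof (rule sublinearI)
    fix a b
    have "S (a + b) \<le> S a + S b"
      using S_ge S_nonneg by (intro S_least) (auto intro: add_mono)
    then show "p (a + b) \<le> p a + p b"
      using M by (simp add: p_def mult_left_mono flip: distrib_left)
  next
    fix a and t :: real assume "0 < t"
    then have "S (t *\<^sub>R a) \<le> t * S a"
      using S_ge S_nonneg by (intro S_least) auto
    then show "p (t *\<^sub>R a) \<le> t * p a"
      using mult_left_mono[OF _ M] by (fastforce simp: p_def algebra_simps)
  qed
  \<comment> \<open>The bounded sequence only has to dominate the constraint values. This makes the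
    set convex and admits points whose constraint values are unbounded below.\<close>
  define C where "C = {c. \<exists>x. (\<forall>k. h k x \<le> ereal (apply_bcontfun (fst c) k)) \<and> f0 x \<le> ereal (snd c)}"
  have "convex C"
  proof (rule convexI)
    fix c c' and u w :: real
    assume c: "c \<in> C" and c': "c' \<in> C" and uw: "0 \<le> u" "0 \<le> w" "u + w = 1"
    obtain x where x: "\<And>k. h k x \<le> ereal (apply_bcontfun (fst c) k)" "f0 x \<le> ereal (snd c)"
      using c unfolding C_def by blast
    obtain y where y: "\<And>k. h k y \<le> ereal (apply_bcontfun (fst c') k)" "f0 y \<le> ereal (snd c')"
      using c' unfolding C_def by blast
    have "h k (u *\<^sub>R x + w *\<^sub>R y) \<le> ereal (apply_bcontfun (fst (u *\<^sub>R c + w *\<^sub>R c')) k)" for k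
      using convex_efun_le[OF conv x(1) y(1) uw] by simp
    moreover have "f0 (u *\<^sub>R x + w *\<^sub>R y) \<le> ereal (snd (u *\<^sub>R c + w *\<^sub>R c'))"
      using convex_efun_le[OF conv0 x(2) y(2) uw] by simp
    ultimately show "u *\<^sub>R c + w *\<^sub>R c' \<in> C"
      unfolding C_def by blast
  qed
  moreover have "(const_bcontfun (- \<eta>), r') \<in> C"
    unfolding C_def using h' r' by (intro CollectI exI[of _ x']) simp
  moreover have "v \<le> p a + r" if "(a, r) \<in> C" for a r
  proof -
    obtain x where x: "\<And>k. h k x \<le> ereal (apply_bcontfun a k)" "f0 x \<le> ereal r"
      using \<open>(a, r) \<in> C\<close> by (auto simp: C_def)
    have "h k x \<le> ereal (S a)" for k
      using x(1)[of k] S_ge[of a k] by (meson ereal_less_eq(3) order_trans)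
    then show ?thesis
      unfolding p_def M_def
      by (intro slater_exact_penalty[where ?f0.0 = f0 and h = h and x = x and x' = x'])
        (use conv0 conv h' \<eta> opt x(2) S_nonneg r' in auto)
  qed
  ultimately obtain L where L: "linear L" "\<And>a. L a \<le> p a" "\<And>a r. (a, r) \<in> C \<Longrightarrow> v \<le> L a + r"
    using Hahn_Banach_Lagrange[OF p, of C v] by fastforce
  \<comment> \<open>Positivity is inherited from the penalty, which ignores negative
    entries.\<close>
  have neg: "L a \<le> 0" if "\<And>k. apply_bcontfun a k \<le> 0" for a
  proof -
    have "S a \<le> 0" using that by (intro S_least) auto
    then have "p a \<le> 0" using M by (simp add: p_def mult_nonneg_nonpos)
    then show ?thesis using L(2)[of a] by simp
  qed
  obtain lam li where lam: "\<And>k. 0 \<le> lam k" "summable lam" "0 \<le> li"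
    and L_le: "\<And>a s. (\<forall>\<^sub>F k in sequentially. apply_bcontfun a k \<le> s) \<Longrightarrow>
      summable (\<lambda>k. lam k * apply_bcontfun a k) \<and> L a \<le> (\<Sum>k. lam k * apply_bcontfun a k) + li * s"
    using positive_functional_le_series_limsup[OF L(1) neg] by blast
  have "ereal v \<le> f0 x + limsup (\<lambda>n. \<Sum>k<n. smul (lam k) (h k x)) + smul li (limsup (\<lambda>k. h k x))"
    (is "_ \<le> _ + ?s + ?l") for x
  proof -
    \<comment> \<open>If a value is +\<infinity>, the conventions for \<open>smul\<close> and for
      adding opposite infinities make the right-hand side infinite; the content is in the last
      case.\<close>
    consider "f0 x = \<infinity>" | k where "h k x = \<infinity>" | "limsup (\<lambda>k. h k x) = \<infinity>"
      | "f0 x < \<infinity>" "\<And>k. h k x < \<infinity>" "limsup (\<lambda>k. h k x) < \<infinity>"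
      unfolding ereal_infty_less by blast
    then show ?thesis
    proof cases
      case (2 k)
      have "(\<Sum>k<n. smul (lam k) (h k x)) = \<infinity>" if "k < n" for n
        using 2 that lam(1) by (intro sum_ereal_PInf[of _ k]) auto
      then have "\<forall>\<^sub>F n in sequentially. (\<Sum>k<n. smul (lam k) (h k x)) = \<infinity>"
        by (auto simp: eventually_sequentially intro!: exI[of _ "Suc k"])
      then have "?s = limsup (\<lambda>n. \<infinity>)"
        by (rule Limsup_eq)
      then have "?s = \<infinity>" by (simp add: Limsup_const)
      then show ?thesis by simp
    next
      case 4
      obtain r where r: "f0 x = ereal r"
        using 4(1) proper0[of x] by (cases "f0 x") auto
      define y where "y k = real_of_ereal (h k x)" for k
      have y: "h k x = ereal (y k)" for k
        using 4(2)[of k] proper[of k x] by (cases "h k x") (auto simp: y_def)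
      obtain B where B: "0 \<le> B" "\<And>k. y k \<le> B"
        using bounded_above_of_limsup[OF 4(3) 4(2)] by (auto simp: y)
      define l where "l = limsup (\<lambda>k. h k x)"
      have main: "summable (\<lambda>k. lam k * y k) \<and> v - r - li * s \<le> (\<Sum>k. lam k * y k)"
        if s: "l < ereal s" for s
      proof -
        \<comment> \<open>The nonnegative terms \<open>lam k * (B - y k)\<close> let an estimate of
          an infinite series pass to its partial sums. Bounded partial sums then give convergence
          and the value estimate together.\<close>
        have part: "(\<Sum>k<n. lam k * (B - y k)) \<le> B * suminf lam - (v - r - li * s)" for n
        proof -
          \<comment> \<open>the values may be unbounded below; truncation at \<open>- N\<close> puts them into the sequence space
             without changing the first \<open>n\<close> of them\<close>
          define N where "N = \<bar>s\<bar> + (\<Sum>k<n. \<bar>y k\<bar>)"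
          define a where "a = Bcontfun (\<lambda>k. max (y k) (- N))"
          have N_nonneg: "0 \<le> N" by (auto simp: N_def intro!: add_nonneg_nonneg sum_nonneg)
          have "\<bar>max (y k) (- N)\<bar> \<le> B + N" for k
            using B(1) B(2)[of k] N_nonneg by (auto simp: max_def)
          then have a: "apply_bcontfun a k = max (y k) (- N)" for k
            unfolding a_def by (subst apply_Bcontfun_discrete) (auto intro!: boundedI)
          have "- N \<le> s" unfolding N_def using sum_nonneg[of "{..<n}" "\<lambda>k. \<bar>y k\<bar>"] by linarith
          have "\<forall>\<^sub>F k in sequentially. h k x < ereal s"
            using s unfolding l_def by (rule Limsup_lessD)
          then have "\<forall>\<^sub>F k in sequentially. apply_bcontfun a k \<le> s"
            by eventually_elim (use \<open>- N \<le> s\<close> in \<open>auto simp: a y\<close>)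
          note La = L_le[OF this]
          have "(a, r) \<in> C"
            unfolding C_def by (intro CollectI exI[of _ x]) (simp add: a y r)
          then have va: "v - r - li * s \<le> (\<Sum>k. lam k * apply_bcontfun a k)"
            using L(3)[of a r] La by linarith
          have small: "a k = y k" if "k < n" for k
          proof -
            have "\<bar>y k\<bar> \<le> (\<Sum>k<n. \<bar>y k\<bar>)"
              using that by (intro member_le_sum) auto
            then show ?thesis by (auto simp: a N_def)
          qed
          have sm: "summable (\<lambda>k. lam k * (B - a k))"
            using summable_diff[OF summable_mult2[OF lam(2), of B]] La by (simp add: right_diff_distrib)
          have "(\<Sum>k<n. lam k * (B - y k)) = (\<Sum>k<n. lam k * (B - a k))"
            by (simp add: small)
          also have "\<dots> \<le> (\<Sum>k. lam k * (B - a k))"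
            using lam(1) B(1) B(2) N_nonneg by (intro sum_le_suminf sm) (auto simp: a intro!: mult_nonneg_nonneg)
          also have "\<dots> = B * suminf lam - (\<Sum>k. lam k * a k)"
            using suminf_diff[OF summable_mult2[OF lam(2), of B]] La suminf_mult2[OF lam(2), of B]
            by (simp add: right_diff_distrib mult.commute)
          finally show ?thesis using va by linarith
        qed
        have sm: "summable (\<lambda>k. lam k * (B - y k))"
          using lam(1) B(2) by (intro summableI_nonneg_bounded[OF _ part]) auto
        then have smy: "summable (\<lambda>k. lam k * y k)"
          using summable_diff[OF summable_mult2[OF lam(2), of B] sm] by (simp add: right_diff_distrib)
        have "(\<Sum>k. lam k * (B - y k)) \<le> B * suminf lam - (v - r - li * s)"
          by (rule suminf_le_const[OF sm part])
        moreover have "(\<Sum>k. lam k * (B - y k)) = B * suminf lam - (\<Sum>k. lam k * y k)"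
          using suminf_diff[OF summable_mult2[OF lam(2), of B] smy] suminf_mult2[OF lam(2), of B]
          by (simp add: right_diff_distrib mult.commute)
        ultimately show ?thesis using smy by simp
      qed
      define Y where "Y = (\<Sum>k. lam k * y k)"
      obtain s0 where s0: "l < ereal s0"
        using 4(3) ereal_dense2 unfolding l_def by blast
      have "(\<lambda>n. \<Sum>k<n. lam k * y k) \<longlonglongrightarrow> Y"
        unfolding Y_def using main[OF s0] by (intro summable_LIMSEQ) simp
      then have "(\<lambda>n. \<Sum>k<n. smul (lam k) (h k x)) \<longlonglongrightarrow> ereal Y"
        by (simp add: y)
      then have s_eq: "?s = ereal Y"
        by (intro lim_imp_Limsup) auto
      have le: "v - r - Y \<le> li * s" if "l < ereal s" for s
        using main[OF that] by (simp add: Y_def)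
      have "ereal (v - r - Y) \<le> smul li l"
      proof (cases "li = 0")
        case True
        then show ?thesis using le[OF s0] s0 by (auto simp: smul_def zero_ereal_def)
      next
        case False
        then have li: "0 < li" using lam(3) by simp
        show ?thesis
        proof (cases l)
          case (real t)
          have "(v - r - Y) / li \<le> t + e" if "0 < e" for e
            using le[of "t + e"] that li by (simp add: real field_simps)
          then have "(v - r - Y) / li \<le> t"
            using field_le_epsilon by blast
          then show ?thesis using li by (simp add: real field_simps)
        next
          case PInf
          then show ?thesis using s0 by simp
        next
          case MInf
          \<comment> \<open>With limit superior -\<infinity>, every real \<open>s\<close> is
            admissible; this choice contradicts \<open>le\<close>, so the case is void.\<close>
          have "li * ((v - r - Y) / li - 1) = v - r - Y - li"
            using li unfolding right_diff_distrib[of li _ 1] by simp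
          then show ?thesis using le[of "(v - r - Y) / li - 1"] li MInf by simp
        qed
      qed
      then have "ereal (v - r - Y) \<le> ?l" by (simp add: l_def)
      then show ?thesis
        unfolding s_eq r by (cases ?l) auto
    qed (use lam(3) in auto)
  qed
  then show ?thesis using lam by blast
qed

section \<open>Fuzzy Fermat rule for finite sums\<close>

text \<open>\<open>lsc_at\<close> speaks of punctured neighbourhoods; adding the value at
  \<open>z\<close> itself covers sequences that visit \<open>z\<close>.\<close>

lemma lsc_at_liminf:
  assumes "lsc_at g z" "u \<longlonglongrightarrow> z"
  shows "g z \<le> liminf (\<lambda>m. g (u m))"
  unfolding le_Liminf_iff
proof (intro allI impI)
  fix c assume c: "c < g z"
  then have "c < Liminf (at z) g"
    using assms(1) by (simp add: lsc_at_def)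
  then have "\<forall>\<^sub>F x in at z. c < g x"
    by (rule less_LiminfD)
  then have "\<forall>\<^sub>F x in nhds z. c < g x"
    using c by (auto simp: eventually_at_filter elim!: eventually_mono)
  then show "\<forall>\<^sub>F m in sequentially. c < g (u m)"
    using assms(2) by (auto simp: filterlim_iff)
qed

text \<open>The real lower bounds keep -\<infinity> out of the sums, so superadditivity of the lower
  limit applies term by term.\<close>

lemma ereal_sum_liminf_le:
  fixes F :: "'i \<Rightarrow> nat \<Rightarrow> ereal"
  assumes "\<And>t m. t \<in> I \<Longrightarrow> ereal (b t) \<le> F t m"
  shows "(\<Sum>t\<in>I. liminf (F t)) \<le> liminf (\<lambda>m. \<Sum>t\<in>I. F t m)"
  using assms
proof (induction I rule: infinite_finite_induct)
  case (insert i I)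
  have nm: "liminf (F t) \<noteq> - \<infinity>" if "t \<in> insert i I" for t
  proof -
    have "ereal (b t) \<le> liminf (F t)"
      using insert.prems[OF that] by (intro Liminf_bounded always_eventually allI)
    then show ?thesis by auto
  qed
  have IH: "(\<Sum>t\<in>I. liminf (F t)) \<le> liminf (\<lambda>m. \<Sum>t\<in>I. F t m)"
    using insert by auto
  have "(\<Sum>t\<in>I. liminf (F t)) \<noteq> - \<infinity>"
    using nm by (intro sum_ereal_not_MInf) auto
  then have "liminf (\<lambda>m. \<Sum>t\<in>I. F t m) \<noteq> - \<infinity>"
    using IH by auto
  then have "liminf (F i) + liminf (\<lambda>m. \<Sum>t\<in>I. F t m) \<le> liminf (\<lambda>m. F i m + (\<Sum>t\<in>I. F t m))"
    using nm[of i] by (intro ereal_liminf_add_mono) auto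
  then show ?case
    using insert.hyps add_left_mono[OF IH, of "liminf (F i)"] by (auto intro: order_trans)
qed (auto simp: Liminf_const)

text \<open>Lets convexity along a segment transfer information between an arbitrary point and a
  small ball.\<close>

lemma segment_point_near:
  fixes x y :: "'a::real_normed_vector"
  assumes e: "0 < e"
  obtains t :: real where "0 < t" "t < 1" "dist y ((1 - t) *\<^sub>R y + t *\<^sub>R x) \<le> e"
proof
  define t where "t = min (1/2) (e / (norm (x - y) + 1))"
  show t: "0 < t" "t < 1"
    using e by (auto simp: t_def intro!: divide_pos_pos add_nonneg_pos)
  have "t * norm (x - y) \<le> e / (norm (x - y) + 1) * (norm (x - y) + 1)"
    using e by (intro mult_mono) (auto simp: t_def)
  also have "\<dots> = e"
    by (simp add: add_nonneg_eq_0_iff)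
  also have "t * norm (x - y) = norm (t *\<^sub>R (x - y))"
    using t by simp
  also have "t *\<^sub>R (x - y) = ((1 - t) *\<^sub>R y + t *\<^sub>R x) - y"
    by (simp add: algebra_simps)
  finally show "dist y ((1 - t) *\<^sub>R y + t *\<^sub>R x) \<le> e"
    by (simp only: dist_norm norm_minus_commute[of y])
qed

text \<open>The functions are controlled only on a ball. The local inequality at a point of the
  segment from \<open>y\<close> to \<open>x\<close>, divided by its parameter, is the global one by
  convexity.\<close>

lemma local_subgradient_in_subdiff:
  fixes g :: "'a::real_normed_vector \<Rightarrow> ereal" and X :: "'a \<Rightarrow>\<^sub>L real"
  assumes conv: "convex_efun g" and proper: "\<And>x. g x \<noteq> - \<infinity>" and y: "g y = ereal \<gamma>" and e: "0 < e"
    and loc: "\<And>x \<sigma>. dist y x \<le> e \<Longrightarrow> g x \<le> ereal \<sigma> \<Longrightarrow> \<gamma> + blinfun_apply X (x - y) \<le> \<sigma>"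
  shows "X \<in> subdiff g y"
  unfolding subdiff_def
proof (intro CollectI allI)
  fix x
  show "ereal (blinfun_apply X (x - y)) \<le> g x - g y"
  proof (cases "g x")
    case (real \<sigma>)
    obtain s where s: "0 < s" "s < 1" and near: "dist y ((1 - s) *\<^sub>R y + s *\<^sub>R x) \<le> e"
      using segment_point_near[OF e] by blast
    define z where "z = (1 - s) *\<^sub>R y + s *\<^sub>R x"
    have zy: "z - y = s *\<^sub>R (x - y)"
      by (simp add: z_def algebra_simps)
    have "dist y z \<le> e"
      using near by (simp add: z_def)
    moreover have "g z \<le> ereal ((1 - s) * \<gamma> + s * \<sigma>)"
      unfolding z_def using s by (intro convex_efun_le conv) (auto simp: y real)
    ultimately have "\<gamma> + blinfun_apply X (z - y) \<le> (1 - s) * \<gamma> + s * \<sigma>"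
      by (rule loc)
    then have "s * blinfun_apply X (x - y) \<le> s * (\<sigma> - \<gamma>)"
      unfolding zy blinfun.scaleR_right by (simp add: left_diff_distrib right_diff_distrib)
    then show ?thesis using s by (simp add: real y)
  qed (use proper y in auto)
qed

text \<open>
  The library instance of \<^class>\<open>complete_space\<close> asks for a metric on the domain, which \<^typ>\<open>nat\<close> lacks.
\<close>

lemma complete_UNIV_bcontfun: "complete (UNIV :: ('i::topological_space \<Rightarrow>\<^sub>C 'b::complete_space) set)"
  unfolding complete_def
proof (intro allI impI, elim conjE)
  fix f :: "nat \<Rightarrow> 'i \<Rightarrow>\<^sub>C 'b"
  assume "Cauchy f"
  then obtain g where "uniform_limit UNIV f g sequentially"
    using uniformly_convergent_eq_cauchy[of "\<lambda>_. True" f]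
    unfolding Cauchy_def uniform_limit_sequentially_iff
    by (metis dist_fun_lt_imp_dist_val_lt)
  then show "\<exists>l\<in>UNIV. f \<longlonglongrightarrow> l"
    by (rule uniform_limit_bcontfunE) auto
qed

text \<open>
  The \<open>N + 1\<close> points are the first coordinates of an element of \<^typ>\<open>nat \<Rightarrow>\<^sub>C 'a\<close>; its supremum norm keeps
  the bound \<open>\<eta> / r\<close> independent of \<open>N\<close>. The functional \<open>L\<close> below splits the penalty from the Ekeland
  perturbation, and the penalty part vanishes on the diagonal.
\<close>

theorem fuzzy_fermat_rule:
  fixes g :: "nat \<Rightarrow> 'a::banach \<Rightarrow> ereal"
  assumes conv: "\<And>t. t \<le> N \<Longrightarrow> convex_efun (g t)"
    and proper: "\<And>t x. t \<le> N \<Longrightarrow> g t x \<noteq> - \<infinity>"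
    and lsc: "\<And>t x. t \<le> N \<Longrightarrow> x \<in> cball xb \<rho> \<Longrightarrow> lsc_at (g t) x"
    and lower: "\<And>t x. t \<le> N \<Longrightarrow> x \<in> cball xb \<rho> \<Longrightarrow> ereal (b t) \<le> g t x"
    and xb: "\<And>t. t \<le> N \<Longrightarrow> g t xb < \<infinity>"
    and v: "(\<Sum>t\<le>N. g t xb) = ereal v"
    and r: "0 < r" "r < \<rho>" and \<eta>: "0 < \<eta>" and \<delta>: "0 < \<delta>"
    and near: "\<And>z. (\<And>t. t \<le> N \<Longrightarrow> z t \<in> cball xb \<rho>) \<Longrightarrow> (\<And>t. t \<le> N \<Longrightarrow> dist (z t) (z 0) < \<delta>) \<Longrightarrow>
        ereal (v - \<eta>) \<le> (\<Sum>t\<le>N. g t (z t))"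
  shows "\<exists>y X. (\<forall>t\<le>N. dist xb (y t) \<le> r \<and> g t (y t) < \<infinity> \<and> X t \<in> subdiff (g t) (y t)) \<and>
    (\<Sum>t\<le>N. g t (y t)) \<le> ereal v \<and> norm (\<Sum>t\<le>N. X t) \<le> \<eta> / r"
proof -
  define G where "G t x = real_of_ereal (g t x)" for t x
  have G: "g t x = ereal (G t x)" if "t \<le> N" "g t x < \<infinity>" for t x
    using that proper[of t x] by (cases "g t x") (auto simp: G_def)
  \<comment> \<open>Once some component is at distance \<delta> from component 0, the penalty alone
    bridges the gap between the crude lower bound and \<open>v\<close>; \<open>near\<close> handles
    the remaining points.\<close>
  define \<kappa> where "\<kappa> = max 0 (v - (\<Sum>t\<le>N. b t)) / \<delta>"
  have \<kappa>: "0 \<le> \<kappa>" "v - (\<Sum>t\<le>N. b t) \<le> \<kappa> * \<delta>"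
    using \<delta> by (auto simp: \<kappa>_def)
  define pen where "pen z = \<kappa> * (\<Sum>t\<le>N. norm (apply_bcontfun z t - apply_bcontfun z 0))"
    for z :: "nat \<Rightarrow>\<^sub>C 'a"
  have pen_nonneg: "0 \<le> pen z" for z
    using \<kappa> by (auto simp: pen_def intro!: mult_nonneg_nonneg sum_nonneg)
  define K where "K = {z :: nat \<Rightarrow>\<^sub>C 'a. \<forall>t\<le>N. apply_bcontfun z t \<in> cball xb \<rho> \<and> g t (apply_bcontfun z t) < \<infinity>}"
  define \<phi> where "\<phi> z = (\<Sum>t\<le>N. G t (apply_bcontfun z t)) + pen z" for z
  have sumG: "(\<Sum>t\<le>N. g t (apply_bcontfun z t)) = ereal (\<Sum>t\<le>N. G t (apply_bcontfun z t))" if "z \<in> K" for z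
    using that G by (subst sum_ereal[symmetric]) (auto simp: K_def intro!: sum.cong)
  have closed_sub: "closed {z\<in>K. \<phi> z \<le> \<alpha>}" for \<alpha>
    unfolding closed_sequential_limits
  proof (intro allI impI, elim conjE)
    fix u l assume u: "\<forall>n. u n \<in> {z\<in>K. \<phi> z \<le> \<alpha>}" and lim: "u \<longlonglongrightarrow> l"
    have lim_t: "(\<lambda>m. apply_bcontfun (u m) t) \<longlonglongrightarrow> apply_bcontfun l t" for t
      using tendsto_bcontfun_uniform_limit[OF lim] by (rule tendsto_uniform_limitI) simp
    have l_mem: "apply_bcontfun l t \<in> cball xb \<rho>" if "t \<le> N" for t
      using u that by (intro Lim_in_closed_set[OF closed_cball _ _ lim_t]) (auto simp: K_def)
    have "(\<Sum>t\<le>N. g t (apply_bcontfun l t)) \<le> (\<Sum>t\<le>N. liminf (\<lambda>m. g t (apply_bcontfun (u m) t)))"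
      by (intro sum_mono lsc_at_liminf[OF lsc lim_t] l_mem) auto
    also have "\<dots> \<le> liminf (\<lambda>m. \<Sum>t\<le>N. g t (apply_bcontfun (u m) t))"
      using u by (intro ereal_sum_liminf_le[where b = b] lower) (auto simp: K_def)
    also have "\<dots> \<le> liminf (\<lambda>m. ereal (\<alpha> - pen (u m)))"
    proof (intro Liminf_mono always_eventually allI)
      fix m
      show "(\<Sum>t\<le>N. g t (apply_bcontfun (u m) t)) \<le> ereal (\<alpha> - pen (u m))"
        using u[rule_format, of m] sumG[of "u m"] by (simp add: \<phi>_def)
    qed
    also have "\<dots> = ereal (\<alpha> - pen l)"
    proof (rule lim_imp_Liminf)
      show "(\<lambda>m. ereal (\<alpha> - pen (u m))) \<longlonglongrightarrow> ereal (\<alpha> - pen l)"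
        unfolding pen_def by (intro tendsto_intros lim_t)
    qed simp
    finally have le: "(\<Sum>t\<le>N. g t (apply_bcontfun l t)) \<le> ereal (\<alpha> - pen l)" .
    then have "g t (apply_bcontfun l t) < \<infinity>" if "t \<le> N" for t
      using sum_ereal_PInf[of "{..N}" t "\<lambda>t. g t (apply_bcontfun l t)"] that by fastforce
    then have "l \<in> K" using l_mem by (auto simp: K_def)
    then show "l \<in> {z\<in>K. \<phi> z \<le> \<alpha>}"
      using le sumG by (simp add: \<phi>_def)
  qed
  have complete_sub: "complete {z\<in>K. \<phi> z \<le> \<alpha>}" for \<alpha>
    using complete_Int_closed[OF complete_UNIV_bcontfun closed_sub, of \<alpha>] by simp
  have \<phi>_ge: "v - \<eta> \<le> \<phi> z" if z: "z \<in> K" for z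
  proof (cases "\<forall>t\<le>N. dist (apply_bcontfun z t) (apply_bcontfun z 0) < \<delta>")
    case True
    then have "ereal (v - \<eta>) \<le> (\<Sum>t\<le>N. g t (apply_bcontfun z t))"
      using z by (intro near) (auto simp: K_def)
    then show ?thesis
      using pen_nonneg[of z] by (simp add: sumG[OF z] \<phi>_def)
  next
    case False
    then obtain t where t: "t \<le> N" "\<delta> \<le> norm (apply_bcontfun z t - apply_bcontfun z 0)"
      by (auto simp: dist_norm not_less)
    have "norm (apply_bcontfun z t - apply_bcontfun z 0)
        \<le> (\<Sum>t\<le>N. norm (apply_bcontfun z t - apply_bcontfun z 0))"
      using t by (intro member_le_sum) auto
    then have "\<kappa> * \<delta> \<le> pen z"
      unfolding pen_def using t \<kappa> by (intro mult_left_mono) auto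
    moreover have "(\<Sum>t\<le>N. b t) \<le> (\<Sum>t\<le>N. G t (apply_bcontfun z t))"
    proof (rule sum_mono)
      fix t assume "t \<in> {..N}"
      then show "b t \<le> G t (apply_bcontfun z t)"
        using z lower[of t "apply_bcontfun z t"] G[of t "apply_bcontfun z t"] by (auto simp: K_def)
    qed
    ultimately show ?thesis using \<kappa> \<eta> by (simp add: \<phi>_def)
  qed
  \<comment> \<open>The start \<open>x0\<close> is \<eta>-minimal, so the Ekeland slope
    \<open>\<eta> / r\<close> keeps the new point within distance \<open>r\<close>.\<close>
  define c where "c = \<eta> / r"
  have c: "0 < c" using \<eta> r by (simp add: c_def)
  define x0 :: "nat \<Rightarrow>\<^sub>C 'a" where "x0 = const_bcontfun xb"
  have x0K: "x0 \<in> K" using xb r by (auto simp: K_def x0_def)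
  have \<phi>_x0: "\<phi> x0 = v"
    using sumG[OF x0K] v by (simp add: \<phi>_def pen_def x0_def)
  obtain y where yK: "y \<in> K" and y1: "\<phi> y + c * dist x0 y \<le> \<phi> x0"
    and y2: "\<And>z. z \<in> K \<Longrightarrow> \<phi> y \<le> \<phi> z + c * dist z y"
    using Ekeland_variational_principle[OF complete_sub \<phi>_ge x0K c] by blast
  have "c * dist x0 y \<le> c * r"
    using y1 \<phi>_ge[OF yK] r by (simp add: \<phi>_x0 c_def)
  then have "dist x0 y \<le> r" using c by simp
  then have y_near: "dist xb (apply_bcontfun y t) \<le> r" for t
    using dist_bounded[of x0 t y] by (simp add: x0_def)
  have y_fin: "g t (apply_bcontfun y t) = ereal (G t (apply_bcontfun y t))" if "t \<le> N" for t
    using yK that by (intro G) (auto simp: K_def)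
  have y_val: "(\<Sum>t\<le>N. g t (apply_bcontfun y t)) \<le> ereal v"
  proof -
    have "0 \<le> c * dist x0 y" using c by simp
    then have "\<phi> y \<le> v" using y1 \<phi>_x0 by linarith
    then have "(\<Sum>t\<le>N. G t (apply_bcontfun y t)) \<le> v"
      using pen_nonneg[of y] unfolding \<phi>_def by linarith
    then show ?thesis by (simp add: sumG[OF yK])
  qed
  \<comment> \<open>The penalty is sublinear in \<open>z\<close>, while the Ekeland term is a norm
    of \<open>z - y\<close>. Treating \<open>z\<close> and \<open>z - y\<close> as separate
    coordinates makes their sum sublinear in the pair.\<close>
  define p where "p q = pen (fst q) + c * norm (snd q)" for q :: "(nat \<Rightarrow>\<^sub>C 'a) \<times> (nat \<Rightarrow>\<^sub>C 'a)"
  have p: "sublinear p"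
  proof (rule sublinearI)
    fix q q' :: "(nat \<Rightarrow>\<^sub>C 'a) \<times> (nat \<Rightarrow>\<^sub>C 'a)"
    have "pen (fst q + fst q') \<le> pen (fst q) + pen (fst q')"
      unfolding pen_def distrib_left[symmetric] sum.distrib[symmetric]
    proof (intro mult_left_mono sum_mono \<kappa>)
      fix t
      show "norm (apply_bcontfun (fst q + fst q') t - apply_bcontfun (fst q + fst q') 0)
          \<le> norm (apply_bcontfun (fst q) t - apply_bcontfun (fst q) 0)
            + norm (apply_bcontfun (fst q') t - apply_bcontfun (fst q') 0)"
        by (simp add: add_diff_add norm_triangle_ineq)
    qed
    moreover have "c * norm (snd q + snd q') \<le> c * norm (snd q) + c * norm (snd q')"
      using c norm_triangle_ineq[of "snd q" "snd q'"] by (simp flip: distrib_left)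
    ultimately show "p (q + q') \<le> p q + p q'" by (simp add: p_def)
  next
    fix q :: "(nat \<Rightarrow>\<^sub>C 'a) \<times> (nat \<Rightarrow>\<^sub>C 'a)" and t :: real assume "0 < t"
    then show "p (t *\<^sub>R q) \<le> t * p q"
      by (simp add: p_def pen_def sum_distrib_left algebra_simps flip: scaleR_diff_right)
  qed
  \<comment> \<open>Each component has its own bound \<open>\<sigma> t\<close>, so that a single
    component can be varied later while the others keep their values.\<close>
  define C where "C = {(q, s). snd q = fst q - y \<and> (\<forall>t\<le>N. apply_bcontfun (fst q) t \<in> cball xb \<rho>) \<and>
    (\<exists>\<sigma>. (\<forall>t\<le>N. g t (apply_bcontfun (fst q) t) \<le> ereal (\<sigma> t)) \<and> s = (\<Sum>t\<le>N. \<sigma> t))}"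
  have C_I: "((z, z - y), \<Sum>t\<le>N. \<sigma> t) \<in> C"
    if "\<And>t. t \<le> N \<Longrightarrow> apply_bcontfun z t \<in> cball xb \<rho>" "\<And>t. t \<le> N \<Longrightarrow> g t (apply_bcontfun z t) \<le> ereal (\<sigma> t)"
    for z \<sigma>
    using that by (auto simp: C_def)
  have "convex C"
  proof (rule convexI)
    fix a a' and u w :: real
    assume a: "a \<in> C" "a' \<in> C" and uw: "0 \<le> u" "0 \<le> w" "u + w = 1"
    obtain z \<sigma> where z: "a = ((z, z - y), \<Sum>t\<le>N. \<sigma> t)" "\<And>t. t \<le> N \<Longrightarrow> apply_bcontfun z t \<in> cball xb \<rho>"
      "\<And>t. t \<le> N \<Longrightarrow> g t (apply_bcontfun z t) \<le> ereal (\<sigma> t)"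
      using a(1) by (auto simp: C_def)
    obtain z' \<sigma>' where z': "a' = ((z', z' - y), \<Sum>t\<le>N. \<sigma>' t)" "\<And>t. t \<le> N \<Longrightarrow> apply_bcontfun z' t \<in> cball xb \<rho>"
      "\<And>t. t \<le> N \<Longrightarrow> g t (apply_bcontfun z' t) \<le> ereal (\<sigma>' t)"
      using a(2) by (auto simp: C_def)
    have "u *\<^sub>R (z - y) + w *\<^sub>R (z' - y) = u *\<^sub>R z + w *\<^sub>R z' - (u + w) *\<^sub>R y"
      by (simp add: algebra_simps)
    then have "u *\<^sub>R a + w *\<^sub>R a' = ((u *\<^sub>R z + w *\<^sub>R z', (u *\<^sub>R z + w *\<^sub>R z') - y), \<Sum>t\<le>N. u * \<sigma> t + w * \<sigma>' t)"
      by (simp add: z(1) z'(1) uw(3) sum.distrib sum_distrib_left)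
    also have "\<dots> \<in> C"
      using convexD[OF convex_cball z(2) z'(2) uw] convex_efun_le[OF conv z(3) z'(3) uw]
      by (intro C_I) auto
    finally show "u *\<^sub>R a + w *\<^sub>R a' \<in> C" .
  qed
  moreover have "((y, y - y), \<Sum>t\<le>N. G t (apply_bcontfun y t)) \<in> C"
    using yK y_fin by (intro C_I) (auto simp: K_def)
  moreover have "\<phi> y \<le> p q + s" if "(q, s) \<in> C" for q s
  proof -
    obtain z \<sigma> where z: "q = (z, z - y)" "s = (\<Sum>t\<le>N. \<sigma> t)" "\<And>t. t \<le> N \<Longrightarrow> apply_bcontfun z t \<in> cball xb \<rho>"
      "\<And>t. t \<le> N \<Longrightarrow> g t (apply_bcontfun z t) \<le> ereal (\<sigma> t)"
      using \<open>(q, s) \<in> C\<close> by (cases q) (auto simp: C_def)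
    have zK: "z \<in> K" using z(3,4) by (fastforce simp: K_def)
    have "(\<Sum>t\<le>N. G t (apply_bcontfun z t)) \<le> s"
      unfolding z(2)
    proof (rule sum_mono)
      fix t assume "t \<in> {..N}"
      then show "G t (apply_bcontfun z t) \<le> \<sigma> t"
        using z(4)[of t] G[of t "apply_bcontfun z t"] zK by (auto simp: K_def)
    qed
    then show ?thesis
      using y2[OF zK] by (simp add: z(1) p_def \<phi>_def dist_norm)
  qed
  ultimately obtain L where L: "linear L" "\<And>q. L q \<le> p q" "\<And>q s. (q, s) \<in> C \<Longrightarrow> \<phi> y \<le> L q + s"
    using Hahn_Banach_Lagrange[OF p, of C "\<phi> y"] by fastforce
  \<comment> \<open>\<open>L (y, 0) \<le> pen y\<close> cancels the penalty contained in
    \<open>\<phi> y\<close>, leaving an inequality between the functions and increments of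
    \<open>L\<close>.\<close>
  have key: "(\<Sum>t\<le>N. G t (apply_bcontfun y t)) \<le> L (d, d) + (\<Sum>t\<le>N. \<sigma> t)"
    if "\<And>t. t \<le> N \<Longrightarrow> apply_bcontfun (y + d) t \<in> cball xb \<rho>"
      "\<And>t. t \<le> N \<Longrightarrow> g t (apply_bcontfun (y + d) t) \<le> ereal (\<sigma> t)" for d \<sigma>
  proof -
    have "\<phi> y \<le> L (y + d, y + d - y) + (\<Sum>t\<le>N. \<sigma> t)"
      by (intro L(3) C_I that)
    also have "L (y + d, y + d - y) = L (y, 0) + L (d, d)"
      using linear_add[OF L(1), of "(y, 0)" "(d, d)"] by simp
    also have "L (y, 0) \<le> pen y"
      using L(2)[of "(y, 0)"] by (simp add: p_def)
    finally show ?thesis by (simp add: \<phi>_def)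
  qed
  define emb :: "nat \<Rightarrow> 'a \<Rightarrow> nat \<Rightarrow>\<^sub>C 'a" where "emb t h = Bcontfun (\<lambda>i. if i = t then h else 0)" for t h
  have emb: "apply_bcontfun (emb t h) i = (if i = t then h else 0)" for t h i
    unfolding emb_def by (subst apply_Bcontfun_discrete) (auto intro!: boundedI[of _ "norm h"])
  have emb_add: "emb t (h + h') = emb t h + emb t h'" for t h h'
    by (rule bcontfun_eqI) (simp add: emb)
  have emb_scaleR: "emb t (a *\<^sub>R h) = a *\<^sub>R emb t h" for t a h
    by (rule bcontfun_eqI) (simp add: emb)
  define X where "X t h = - L (emb t h, emb t h)" for t h
  have X_lin: "linear (X t)" for t
  proof (rule linearI)
    show "X t (h + h') = X t h + X t h'" for h h'
      using linear_add[OF L(1), of "(emb t h, emb t h)" "(emb t h', emb t h')"]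
      by (simp add: X_def emb_add)
    show "X t (a *\<^sub>R h) = a *\<^sub>R X t h" for a h
      using linear_scale[OF L(1), of a "(emb t h, emb t h)"] by (simp add: X_def emb_scaleR)
  qed
  \<comment> \<open>A crude constant, depending on \<open>N\<close>, for the continuity of the
    single functionals; their sum gets the sharper bound \<open>c\<close>.\<close>
  define Q where "Q = \<kappa> * (\<Sum>t\<le>N. 2) + c"
  have X_neg: "- X t h \<le> Q * norm h" for t h
  proof -
    have "pen (emb t h) \<le> \<kappa> * (\<Sum>t\<le>N. 2 * norm h)"
      unfolding pen_def by (intro mult_left_mono sum_mono \<kappa>) (auto simp: emb)
    moreover have "norm (emb t h) \<le> norm h"
      by (rule norm_bound) (auto simp: emb)
    then have "c * norm (emb t h) \<le> c * norm h" using c by simp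
    ultimately have "p (emb t h, emb t h) \<le> Q * norm h"
      by (simp add: p_def Q_def sum_distrib_right algebra_simps)
    then show ?thesis using L(2)[of "(emb t h, emb t h)"] by (simp add: X_def)
  qed
  have X_bl: "bounded_linear (X t)" for t
  proof (rule bounded_linear_intro)
    show "norm (X t h) \<le> norm h * Q" for h
      using X_neg[of t h] X_neg[of t "- h"] linear_neg[OF X_lin[of t], of h]
      by (simp add: abs_le_iff mult.commute)
  qed (use X_lin linear_add linear_scale in blast)+
  define Y where "Y t = Blinfun (X t)" for t
  have Y: "blinfun_apply (Y t) = X t" for t
    unfolding Y_def by (rule bounded_linear_Blinfun_apply[OF X_bl])
  have Y_sub: "Y t \<in> subdiff (g t) (apply_bcontfun y t)" if t: "t \<le> N" for t
  proof (rule local_subgradient_in_subdiff[where e = "\<rho> - r"])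
    show "convex_efun (g t)" "\<And>x. g t x \<noteq> - \<infinity>" using conv proper t by auto
    show "g t (apply_bcontfun y t) = ereal (G t (apply_bcontfun y t))" by (rule y_fin[OF t])
    show "0 < \<rho> - r" using r by simp
    fix x \<sigma> assume x: "dist (apply_bcontfun y t) x \<le> \<rho> - r" "g t x \<le> ereal \<sigma>"
    define d where "d = emb t (x - apply_bcontfun y t)"
    have yd: "apply_bcontfun y i + apply_bcontfun d i = (if i = t then x else apply_bcontfun y i)" for i
      by (simp add: d_def emb)
    have "dist xb x \<le> \<rho>"
      using y_near[of t] x(1) dist_triangle[of xb x "apply_bcontfun y t"] by linarith
    then have "(\<Sum>i\<le>N. G i (apply_bcontfun y i))
        \<le> L (d, d) + (\<Sum>i\<le>N. if i = t then \<sigma> else G i (apply_bcontfun y i))"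
      using x(2) y_fin yK by (intro key) (auto simp: yd K_def)
    then show "G t (apply_bcontfun y t) + blinfun_apply (Y t) (x - apply_bcontfun y t) \<le> \<sigma>"
      using t by (simp add: Y X_def d_def[symmetric] sum.remove[of "{..N}" t])
  qed
  have Y_norm: "norm (\<Sum>t\<le>N. Y t) \<le> c"
  proof (rule norm_blinfun_bound)
    fix h
    have Y_sum: "- blinfun_apply (\<Sum>t\<le>N. Y t) h \<le> c * norm h" for h
    proof -
      define D where "D = (\<Sum>t\<le>N. emb t h)"
      have D: "apply_bcontfun D i = (if i \<le> N then h else 0)" for i
        by (simp add: D_def apply_bcontfun_sum emb)
      have "L (D, D) = (\<Sum>t\<le>N. L (emb t h, emb t h))"
        using linear_sum[OF L(1), of "\<lambda>t. (emb t h, emb t h)" "{..N}"]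
        by (simp add: D_def sum_prod)
      then have "- blinfun_apply (\<Sum>t\<le>N. Y t) h = L (D, D)"
        by (simp add: blinfun.sum_left Y X_def sum_negf)
      also have "\<dots> \<le> p (D, D)" by (rule L(2))
      also have "\<dots> = c * norm D" by (simp add: p_def pen_def D)
      also have "\<dots> \<le> c * norm h"
        using c by (intro mult_left_mono norm_bound) (auto simp: D)
      finally show ?thesis .
    qed
    show "norm (blinfun_apply (\<Sum>t\<le>N. Y t) h) \<le> c * norm h"
      using Y_sum[of h] Y_sum[of "- h"] by (simp add: blinfun.minus_right abs_le_iff)
  qed (use c in simp)
  show ?thesis
    using y_near y_fin Y_sub y_val Y_norm
    by (intro exI[of _ "apply_bcontfun y"] exI[of _ Y]) (auto simp: c_def)
qed

section \<open>Uniform lower semicontinuity of the weighted family\<close>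

text \<open>The inner infimum increases as \<delta> decreases, so its one-sided limit is a supremum
  and the nested suprema and infima can be read as quantifiers.\<close>

lemma Lambda_U_geD:
  fixes g :: "'t \<Rightarrow> 'a::metric_space \<Rightarrow> ereal"
  assumes "ereal v \<le> Lambda_U U g" "0 < \<eta>"
  obtains S0 where "finite S0"
    "\<And>S. finite S \<Longrightarrow> S0 \<subseteq> S \<Longrightarrow> \<exists>\<delta>>0. \<forall>xs. (\<forall>t\<in>S. xs t \<in> U) \<and> diameter (xs ` S) < \<delta> \<longrightarrow>
      ereal (v - \<eta>) \<le> (\<Sum>t\<in>S. g t (xs t))"
proof -
  define V where "V S \<delta> = {xs. (\<forall>t\<in>S. xs t \<in> U) \<and> diameter (xs ` S) < \<delta>}" for S :: "'t set" and \<delta> :: real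
  define F where "F S \<delta> = (INF xs\<in>V S \<delta>. \<Sum>t\<in>S. g t (xs t))" for S \<delta>
  have mono: "F S \<delta>' \<le> F S \<delta>" if "\<delta> \<le> \<delta>'" for S \<delta> \<delta>'
    unfolding F_def using that by (intro INF_superset_mono) (auto simp: V_def)
  have Lim: "Lim (at_right 0) (F S) = (SUP \<delta>\<in>{0<..}. F S \<delta>)" for S
  proof (rule tendsto_Lim)
    show "(F S \<longlongrightarrow> (SUP \<delta>\<in>{0<..}. F S \<delta>)) (at_right 0)"
    proof (rule order_tendstoI)
      fix a assume "a < (SUP \<delta>\<in>{0<..}. F S \<delta>)"
      then obtain \<delta>0 where \<delta>0: "0 < \<delta>0" "a < F S \<delta>0"
        by (auto simp: less_SUP_iff)
      have "\<forall>\<^sub>F \<delta> in at_right 0. \<delta> \<in> {0<..<\<delta>0}"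
        by (rule eventually_at_rightI[OF _ \<delta>0(1)])
      then show "\<forall>\<^sub>F \<delta> in at_right 0. a < F S \<delta>"
        by eventually_elim (use \<delta>0(2) mono in \<open>auto intro: less_le_trans\<close>)
    next
      fix a assume a: "(SUP \<delta>\<in>{0<..}. F S \<delta>) < a"
      have "\<forall>\<^sub>F \<delta> in at_right (0::real). \<delta> \<in> {0<..<1}"
        by (rule eventually_at_rightI[of _ 1]) simp_all
      then show "\<forall>\<^sub>F \<delta> in at_right 0. F S \<delta> < a"
        by eventually_elim (use a in \<open>auto intro: le_less_trans[OF SUP_upper]\<close>)
    qed
  qed simp
  have "Lambda_U U g = (SUP S0\<in>{S. finite S}. INF S\<in>{S. finite S \<and> S0 \<subseteq> S}. SUP \<delta>\<in>{0<..}. F S \<delta>)"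
    unfolding Lambda_U_def Lim[symmetric] unfolding F_def V_def ..
  moreover have "ereal (v - \<eta>) < Lambda_U U g"
    using assms by (intro less_le_trans[OF _ assms(1)]) simp
  ultimately obtain S0 where S0: "finite S0"
    "ereal (v - \<eta>) < (INF S\<in>{S. finite S \<and> S0 \<subseteq> S}. SUP \<delta>\<in>{0<..}. F S \<delta>)"
    by (auto simp: less_SUP_iff)
  show ?thesis
  proof (rule that[OF S0(1)])
    fix S assume S: "finite S" "S0 \<subseteq> S"
    have "ereal (v - \<eta>) < (SUP \<delta>\<in>{0<..}. F S \<delta>)"
      using S by (intro less_le_trans[OF S0(2)] INF_lower) auto
    then obtain \<delta> where \<delta>: "0 < \<delta>" "ereal (v - \<eta>) < F S \<delta>"
      by (auto simp: less_SUP_iff)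
    have "ereal (v - \<eta>) \<le> (\<Sum>t\<in>S. g t (xs t))" if "xs \<in> V S \<delta>" for xs
      using \<delta>(2) INF_lower[OF that, of "\<lambda>xs. \<Sum>t\<in>S. g t (xs t)"] by (simp add: F_def)
    then show "\<exists>\<delta>>0. \<forall>xs. (\<forall>t\<in>S. xs t \<in> U) \<and> diameter (xs ` S) < \<delta> \<longrightarrow>
        ereal (v - \<eta>) \<le> (\<Sum>t\<in>S. g t (xs t))"
      using \<delta>(1) by (intro exI[of _ \<delta>]) (auto simp: V_def)
  qed
qed

lemma gfam_simps:
  "gfam f lam li \<infinity> = (\<lambda>x. smul li (finf f x))"
  "gfam f lam li (enat 0) = f 0"
  "k \<noteq> 0 \<Longrightarrow> gfam f lam li (enat k) = (\<lambda>x. smul (lam k) (f k x))"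
  by (auto simp: gfam_def fun_eq_iff zero_enat_def)

lemma sum_insert_infinity_enat:
  fixes F :: "enat \<Rightarrow> ereal"
  shows "(\<Sum>t\<in>insert \<infinity> (enat ` {..n}). F t) = F (enat 0) + (\<Sum>k\<in>{1..n}. F (enat k)) + F \<infinity>"
proof -
  have "(\<Sum>t\<in>insert \<infinity> (enat ` {..n}). F t) = F \<infinity> + (\<Sum>t\<in>enat ` {..n}. F t)"
    by (subst sum.insert) auto
  also have "(\<Sum>t\<in>enat ` {..n}. F t) = (\<Sum>k\<le>n. F (enat k))"
    by (subst sum.reindex) (auto simp: inj_on_def)
  also have "\<dots> = F (enat 0) + (\<Sum>k\<in>{1..n}. F (enat k))"
    by (simp add: atMost_atLeast0 sum.atLeast_Suc_atMost)
  finally show ?thesis by (simp add: ac_simps)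
qed

text \<open>Initial segments together with \<infinity> are cofinal among the finite index sets; this
  links ordinary partial sums to limits along finite subsets.\<close>

lemma finite_enat_subset:
  fixes S :: "enat set"
  assumes "finite S"
  obtains n0 where "\<And>n. n0 \<le> n \<Longrightarrow> S \<subseteq> insert \<infinity> (enat ` {..n})"
proof
  \<comment> \<open>A sum of naturals bounds each of its terms; the unspecified value
    \<open>the_enat \<infinity>\<close> can only enlarge it.\<close>
  fix n assume n: "(\<Sum>t\<in>S. the_enat t) \<le> n"
  show "S \<subseteq> insert \<infinity> (enat ` {..n})"
  proof
    fix t assume t: "t \<in> S"
    have "the_enat t \<le> (\<Sum>t\<in>S. the_enat t)"
      using assms t by (intro member_le_sum) auto
    then show "t \<in> insert \<infinity> (enat ` {..n})"
      using n by (cases t) auto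
  qed
qed

text \<open>Index 0 carries the objective, and a limit superior ignores a finite initial
  piece.\<close>

lemma finf_Suc: "finf f x = limsup (\<lambda>k. f (Suc k) x)"
  unfolding finf_def using limsup_shift[of "\<lambda>k. f k x"] by simp

text \<open>The Lagrangian uses ordinary partial sums, uniform lower semicontinuity a net of finite
  sums. The supremum over all supersets of \<open>S0\<close> dominates the late partial sums, hence
  their limit superior.\<close>

lemma lagrangian_le_sum_bar:
  assumes proper: "\<And>k x. f k x \<noteq> - \<infinity>" and lam: "lam \<in> l1_plus" "0 \<le> li"
    and lag: "ereal v \<le> lagr f lam li x"
  shows "ereal v \<le> sum_bar (gfam f lam li) x"
  unfolding sum_bar_def
proof (rule INF_greatest)
  fix S0 :: "enat set" assume S0: "S0 \<in> {S. finite S}"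
  define T where "T = (SUP S\<in>{S. finite S \<and> S0 \<subseteq> S}. \<Sum>t\<in>S. gfam f lam li t x)"
  define A where "A n = (\<Sum>k\<in>{1..n}. smul (lam k) (f k x))" for n
  obtain n0 where n0: "\<And>n. n0 \<le> n \<Longrightarrow> S0 \<subseteq> insert \<infinity> (enat ` {..n})"
    using finite_enat_subset S0 by auto
  have T: "f 0 x + A n + smul li (finf f x) \<le> T" if "n0 \<le> n" for n
  proof -
    have "(\<Sum>t\<in>insert \<infinity> (enat ` {..n}). gfam f lam li t x) \<le> T"
      unfolding T_def using n0[OF that] by (intro SUP_upper) auto
    then show ?thesis
      unfolding sum_insert_infinity_enat by (simp add: gfam_simps A_def)
  qed
  have nonneg: "0 \<le> lam k" if "1 \<le> k" for k
    using lam that by (auto simp: l1_plus_def)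
  consider "f 0 x = \<infinity>" | "finf f x = \<infinity>" | k where "1 \<le> k" "f k x = \<infinity>"
    | "f 0 x < \<infinity>" "\<And>k. f (Suc k) x < \<infinity>" "finf f x < \<infinity>"
    unfolding ereal_infty_less by (metis le_add1 plus_1_eq_Suc)
  then have "ereal v \<le> T"
  proof cases
    case 1
    then show ?thesis using T[of n0] by simp
  next
    case 2
    then show ?thesis using T[of n0] lam(2) by simp
  next
    case (3 k)
    have "A (max n0 k) = \<infinity>"
      unfolding A_def using 3 nonneg[of k] by (intro sum_ereal_PInf[of _ k]) auto
    then show ?thesis using T[of "max n0 k"] by simp
  next
    case 4
    obtain r where r: "f 0 x = ereal r"
      using 4(1) proper[of 0 x] by (cases "f 0 x") auto
    obtain B where B: "0 \<le> B" "\<And>k. f (Suc k) x \<le> ereal B"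
      using bounded_above_of_limsup[of "\<lambda>k. f (Suc k) x"] 4 by (auto simp: finf_Suc)
    have sm: "summable (\<lambda>k. lam (Suc k))"
      using lam(1) by (simp add: l1_plus_def summable_Suc_iff)
    have "A n \<le> ereal (B * (\<Sum>k. lam (Suc k)))" for n
    proof -
      have "A n = (\<Sum>k<n. smul (lam (Suc k)) (f (Suc k) x))"
        by (simp add: A_def sum.atLeast1_atMost_eq)
      also have "\<dots> \<le> (\<Sum>k<n. ereal (lam (Suc k) * B))"
      proof (rule sum_mono)
        fix k
        show "smul (lam (Suc k)) (f (Suc k) x) \<le> ereal (lam (Suc k) * B)"
          using B(2)[of k] proper[of "Suc k" x] nonneg[of "Suc k"]
          by (cases "f (Suc k) x") (auto intro: mult_left_mono)
      qed
      also have "\<dots> = ereal ((\<Sum>k<n. lam (Suc k)) * B)"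
        by (simp add: sum_distrib_right)
      also have "\<dots> \<le> ereal ((\<Sum>k. lam (Suc k)) * B)"
        using B(1) sum_le_suminf[OF sm] nonneg by (auto intro!: mult_right_mono)
      finally show ?thesis by (simp add: mult.commute)
    qed
    then have "limsup A \<le> ereal (B * (\<Sum>k. lam (Suc k)))"
      by (intro Limsup_bounded always_eventually allI)
    then have limsup_fin: "limsup A < \<infinity>" by auto
    \<comment> \<open>Since \<open>limsup A\<close> is below +\<infinity>, this bound excludes
      -\<infinity> for the last summand, which can then be moved to the other side.\<close>
    have v: "ereal v \<le> ereal r + limsup A + smul li (finf f x)"
      using lag by (simp add: lagr_def A_def[abs_def] r)
    have "smul li (finf f x) < \<infinity>"
      using 4(3) lam(2) by (cases "finf f x") (auto simp: smul_def)
    moreover have "smul li (finf f x) \<noteq> - \<infinity>"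
      using v limsup_fin by (cases "limsup A") auto
    ultimately obtain \<gamma> where \<gamma>: "smul li (finf f x) = ereal \<gamma>"
      by (cases "smul li (finf f x)") auto
    have "A n \<le> T - ereal (r + \<gamma>)" if "n0 \<le> n" for n
      using T[OF that] unfolding r \<gamma> by (cases T; cases "A n") auto
    then have "limsup A \<le> T - ereal (r + \<gamma>)"
      by (intro Limsup_bounded) (auto simp: eventually_sequentially)
    then show ?thesis
      using v unfolding \<gamma> by (cases T; cases "limsup A") auto
  qed
  then show "ereal v \<le> (SUP S\<in>{S. finite S \<and> S0 \<subseteq> S}. \<Sum>t\<in>S. gfam f lam li t x)"
    by (simp add: T_def)
qed

section \<open>Convexity, finiteness and subgradients of the weighted functions\<close>

lemma convex_efun_finf:
  assumes "\<And>k. convex_efun (f k)"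
  shows "convex_efun (finf f)"
  unfolding convex_efun_def
proof (intro allI impI)
  fix x y and t :: real assume t: "0 < t \<and> t < 1"
  have "finf f ((1 - t) *\<^sub>R x + t *\<^sub>R y) \<le> limsup (\<lambda>k. ereal (1 - t) * f k x + ereal t * f k y)"
    unfolding finf_def using assms t
    by (intro Limsup_mono always_eventually allI) (auto simp: convex_efun_def)
  also have "\<dots> \<le> limsup (\<lambda>k. ereal (1 - t) * f k x) + limsup (\<lambda>k. ereal t * f k y)"
    by (rule ereal_limsup_add_mono)
  also have "\<dots> = ereal (1 - t) * finf f x + ereal t * finf f y"
    unfolding finf_def using t by (simp add: Limsup_ereal_mult_left)
  finally show "finf f ((1 - t) *\<^sub>R x + t *\<^sub>R y) \<le> ereal (1 - t) * finf f x + ereal t * finf f y" .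
qed

text \<open>For \<open>c = 0\<close> the function is the indicator of the effective domain, and the
  claim is convexity of that domain.\<close>

lemma convex_efun_smul:
  fixes g :: "'a::real_vector \<Rightarrow> ereal"
  assumes g: "convex_efun g" and c: "0 \<le> c"
  shows "convex_efun (\<lambda>x. smul c (g x))"
  unfolding convex_efun_def
proof (intro allI impI)
  fix x y :: 'a and t :: real assume t: "0 < t \<and> t < 1"
  define z where "z = (1 - t) *\<^sub>R x + t *\<^sub>R y"
  have z: "g z \<le> ereal (1 - t) * g x + ereal t * g y"
    using g t by (simp add: convex_efun_def z_def)
  have "smul c (g z) \<le> ereal (1 - t) * smul c (g x) + ereal t * smul c (g y)"
  proof (cases "c = 0")
    case True
    show ?thesis
      using z t by (cases "g x"; cases "g y") (auto simp: smul_def True)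
  next
    case False
    then have "smul c (g z) \<le> ereal c * (ereal (1 - t) * g x + ereal t * g y)"
      using z c by (simp add: smul_def ereal_mult_left_mono)
    also have "\<dots> = ereal (1 - t) * smul c (g x) + ereal t * smul c (g y)"
      using False c t by (cases "g x"; cases "g y") (auto simp: smul_def algebra_simps)
    finally show ?thesis .
  qed
  then show "smul c (g ((1 - t) *\<^sub>R x + t *\<^sub>R y)) \<le> ereal (1 - t) * smul c (g x) + ereal t * smul c (g y)"
    by (simp add: z_def)
qed

text \<open>A value -\<infinity> at \<open>w\<close> would spread along the segment towards
  \<open>xb\<close> and reach the ball. This is what excludes -\<infinity> for the weighted limit
  superior.\<close>

lemma convex_efun_not_MInf:
  fixes g :: "'a::real_normed_vector \<Rightarrow> ereal"
  assumes g: "convex_efun g" and xb: "g xb < \<infinity>" and e: "0 < e"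
    and loc: "\<And>x. dist xb x \<le> e \<Longrightarrow> g x \<noteq> - \<infinity>"
  shows "g w \<noteq> - \<infinity>"
proof
  assume w: "g w = - \<infinity>"
  obtain t where t: "0 < t" "t < 1" and near: "dist xb ((1 - t) *\<^sub>R xb + t *\<^sub>R w) \<le> e"
    using segment_point_near[OF e] by blast
  define z where "z = (1 - t) *\<^sub>R xb + t *\<^sub>R w"
  have "dist xb z \<le> e"
    using near by (simp add: z_def)
  moreover have "g z \<le> ereal (1 - t) * g xb + ereal t * g w"
    using g t by (simp add: convex_efun_def z_def)
  then have "g z = - \<infinity>"
    using xb t w by (cases "g xb") auto
  ultimately show False using loc by blast
qed

text \<open>For positive \<open>c\<close> a subgradient is divided by \<open>c\<close>; for
  \<open>c = 0\<close> a subgradient of the indicator of the domain is a normal vector.\<close>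

lemma subdiff_smul_subset_scaled_subdiff:
  assumes c: "0 \<le> c" and X: "X \<in> subdiff (\<lambda>x. smul c (g x)) y"
    and y: "smul c (g y) < \<infinity>" "smul c (g y) \<noteq> - \<infinity>"
  shows "X \<in> scaled_subdiff c g y"
proof (cases "c = 0")
  case True
  have "y \<in> edom g"
    using y(1) by (cases "g y") (auto simp: True edom_def)
  moreover have "blinfun_apply X (w - y) \<le> 0" if "w \<in> edom g" for w
    using X[unfolded subdiff_def, simplified, rule_format, of w] that \<open>y \<in> edom g\<close>
    by (auto simp: True smul_def edom_def zero_ereal_def)
  ultimately show ?thesis
    by (simp add: scaled_subdiff_def True normal_cone_def)
next
  case False
  then have c: "0 < c" using c by simp
  obtain \<gamma> where \<gamma>: "g y = ereal \<gamma>"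
    using y c by (cases "g y") (auto simp: smul_def)
  have "(1 / c) *\<^sub>R X \<in> subdiff g y"
    unfolding subdiff_def
  proof (intro CollectI allI)
    fix w
    have "ereal (blinfun_apply X (w - y)) \<le> smul c (g w) - smul c (g y)"
      using X by (simp add: subdiff_def)
    then show "ereal (blinfun_apply ((1 / c) *\<^sub>R X) (w - y)) \<le> g w - g y"
      using c by (cases "g w") (auto simp: \<gamma> smul_def blinfun.scaleR_left field_simps)
  qed
  then have "c *\<^sub>R ((1 / c) *\<^sub>R X) \<in> (\<lambda>v. c *\<^sub>R v) ` subdiff g y"
    by blast
  then show ?thesis using c by (simp add: scaled_subdiff_def)
qed

section \<open>Optimality conditions\<close>

lemma dual_solution_ge_primal_value:
  fixes f :: "nat \<Rightarrow> 'a::real_vector \<Rightarrow> ereal"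
  assumes proper: "\<And>k x. f k x \<noteq> - \<infinity>" and conv: "\<And>k. convex_efun (f k)"
    and P_sol: "primal_solution f xb" and v: "f 0 xb = ereal v"
    and slater: "\<exists>x\<in>edom (f 0). (SUP k\<in>{1..}. f k x) < 0"
    and D_sol: "dual_solution f lam laminf"
  shows "ereal v \<le> lagr f lam laminf x"
proof -
  obtain x' where x': "f 0 x' < \<infinity>" "(SUP k\<in>{1..}. f k x') < 0"
    using slater by (auto simp: edom_def)
  have "(SUP k. f (Suc k) x') \<le> (SUP k\<in>{1..}. f k x')"
    by (intro SUP_least SUP_upper) auto
  then have x'2: "(SUP k. f (Suc k) x') < 0"
    using x'(2) by simp
  have opt: "ereal v \<le> f 0 x" if x: "\<And>k. f (Suc k) x \<le> 0" for x
  proof (cases "f 0 x = \<infinity>")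
    case False
    have "f k x \<le> 0" if "1 \<le> k" for k
      using x[of "k - 1"] that by simp
    then have "x \<in> feas f"
      using False by (auto simp: feas_def edom_def)
    then show ?thesis using P_sol v by (auto simp: primal_solution_def)
  qed simp
  obtain mu li where mu: "\<And>k. 0 \<le> mu k" "summable mu" "0 \<le> li"
    and le: "\<And>x. ereal v \<le> f 0 x + limsup (\<lambda>n. \<Sum>k<n. smul (mu k) (f (Suc k) x)) +
      smul li (limsup (\<lambda>k. f (Suc k) x))"
    using countable_strong_duality[of "f 0" "\<lambda>k. f (Suc k)", OF conv conv proper proper x'(1) x'2 opt]
    by blast
  \<comment> \<open>The duality theorem numbers the constraints from 0; the multipliers are shifted
    by one, with a filler at index 0.\<close>
  define lam' where "lam' = case_nat 0 mu"
  have "summable (\<lambda>k. lam' (Suc k))"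
    using mu(2) by (simp add: lam'_def)
  then have "summable lam'"
    by (simp only: summable_Suc_iff)
  then have l1: "lam' \<in> l1_plus"
    using mu(1) by (auto simp: l1_plus_def lam'_def split: nat.split)
  have "ereal v \<le> lagr f lam' li x" for x
    using le[of x] by (simp add: lagr_def finf_Suc sum.atLeast1_atMost_eq lam'_def)
  then have "ereal v \<le> dual_val f lam' li"
    unfolding dual_val_def by (intro INF_greatest)
  also have "\<dots> = dual_val f (fst (lam', li)) (snd (lam', li))" by simp
  also have "\<dots> \<le> dual_val f lam laminf"
    using D_sol l1 mu(3) unfolding dual_solution_def
    by (elim conjE, simp only:) (intro SUP_upper, auto)
  also have "\<dots> \<le> lagr f lam laminf x"
    unfolding dual_val_def by (intro INF_lower) auto
  finally show ?thesis .
qed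

text \<open>At a feasible point all weighted terms are nonpositive, so the limit superior of the
  partial sums lies below each single term. The Lagrangian bound makes it nonnegative, and every
  term vanishes.\<close>

lemma complementary_slackness:
  assumes lam: "lam \<in> l1_plus" "0 \<le> li" and feas: "xb \<in> feas f" and v: "f 0 xb = ereal v"
    and lag: "ereal v \<le> lagr f lam li xb"
  shows "\<And>k. 1 \<le> k \<Longrightarrow> smul (lam k) (f k xb) = 0" and "smul li (finf f xb) = 0"
proof -
  have smul_nonpos: "smul c u \<le> 0" if "0 \<le> c" "u \<le> 0" for c u
    using that by (cases u) (auto simp: smul_def mult_nonneg_nonpos)
  have fk: "f k xb \<le> 0" if "1 \<le> k" for k
    using feas that by (auto simp: feas_def)
  have nonpos: "smul (lam k) (f k xb) \<le> 0" if "1 \<le> k" for k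
    using lam(1) fk[OF that] that by (intro smul_nonpos) (auto simp: l1_plus_def)
  have "finf f xb \<le> 0"
    unfolding finf_def by (rule Limsup_bounded)
      (auto simp: eventually_sequentially intro!: exI[of _ 1] fk)
  then have inf: "smul li (finf f xb) \<le> 0"
    using lam(2) by (intro smul_nonpos)
  define A where "A = limsup (\<lambda>n. \<Sum>k\<in>{1..n}. smul (lam k) (f k xb))"
  have A_le: "A \<le> smul (lam k) (f k xb)" if k: "1 \<le> k" for k
    unfolding A_def
  proof (rule Limsup_bounded, unfold eventually_sequentially, intro exI[of _ k] allI impI)
    fix n assume "k \<le> n"
    then have "(\<Sum>k\<in>{1..n}. smul (lam k) (f k xb))
        = smul (lam k) (f k xb) + (\<Sum>k\<in>{1..n} - {k}. smul (lam k) (f k xb))"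
      using k by (intro sum.remove) auto
    also have "\<dots> \<le> smul (lam k) (f k xb) + 0"
      using nonpos by (intro add_left_mono sum_nonpos) auto
    finally show "(\<Sum>k\<in>{1..n}. smul (lam k) (f k xb)) \<le> smul (lam k) (f k xb)" by simp
  qed
  have "ereal v \<le> ereal v + A + smul li (finf f xb)"
    using lag by (simp add: lagr_def A_def v)
  moreover have "A \<le> 0" using A_le[of 1] nonpos[of 1] by simp
  ultimately have "0 \<le> A \<and> 0 \<le> smul li (finf f xb)"
    using inf by (cases A; cases "smul li (finf f xb)") auto
  then show "smul li (finf f xb) = 0" "\<And>k. 1 \<le> k \<Longrightarrow> smul (lam k) (f k xb) = 0"
    using inf nonpos A_le by (auto intro: antisym order_trans)
qed

theorem theorem4p1:
  fixes f :: "nat \<Rightarrow> 'a::banach \<Rightarrow> ereal"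
    and xb :: 'a and lam :: "nat \<Rightarrow> real" and laminf :: real
  assumes proper: "\<And>k. proper_fun (f k)"
    and conv: "\<And>k. convex_efun (f k)"
    and C_ne: "feas f \<noteq> {}"
    and P_sol: "primal_solution f xb"
    and slater: "\<exists>x\<in>edom (f 0). (SUP k\<in>{1..}. f k x) < 0"
    and D_sol: "dual_solution f lam laminf"
    and i: "\<exists>U. open U \<and> xb \<in> U \<and>
              (\<forall>t. (\<forall>x\<in>U. lsc_at (gfam f lam laminf t) x) \<and>
                   (\<exists>b::real. \<forall>x\<in>U. ereal b \<le> gfam f lam laminf t x))"
    and ii: "\<exists>U. open U \<and> xb \<in> U \<and> uniformly_lsc_on U (gfam f lam laminf)"
  shows "(\<forall>k\<ge>1. smul (lam k) (f k xb) = 0) \<and> smul laminf (finf f xb) = 0 \<and>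
    (\<forall>\<epsilon>>0. \<forall>M>0. \<exists>n::nat. real n > M \<and>
       (\<exists>xs::nat \<Rightarrow> 'a. \<exists>xi::'a.
          (\<forall>k\<le>n. xs k \<in> ball xb \<epsilon>) \<and> xi \<in> ball xb \<epsilon> \<and>
          f 0 (xs 0) + (\<Sum>k\<in>{1..n}. smul (lam k) (f k (xs k))) + smul laminf (finf f xi) \<le> f 0 xb \<and>
          (\<exists>y0 ys yi. y0 \<in> subdiff (f 0) (xs 0) \<and>
             (\<forall>k\<in>{1..n}. ys k \<in> scaled_subdiff (lam k) (f k) (xs k)) \<and>
             yi \<in> scaled_subdiff laminf (finf f) xi \<and>
             norm (y0 + (\<Sum>k\<in>{1..n}. ys k) + yi) < \<epsilon>)))"
proof -
  have not_MInf: "f k x \<noteq> - \<infinity>" for k x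
    using proper[of k] by (simp add: proper_fun_def)
  have feas: "xb \<in> feas f" using P_sol by (simp add: primal_solution_def)
  obtain v where v: "f 0 xb = ereal v"
    using feas not_MInf[of 0 xb] by (cases "f 0 xb") (auto simp: feas_def edom_def)
  have l1: "lam \<in> l1_plus" "0 \<le> laminf"
    using D_sol by (auto simp: dual_solution_def)
  have lam_nonneg: "0 \<le> lam k" if "1 \<le> k" for k
    using l1 that by (auto simp: l1_plus_def)
  have lag: "ereal v \<le> lagr f lam laminf x" for x
    by (rule dual_solution_ge_primal_value[OF not_MInf conv P_sol v slater D_sol])
  note slack = complementary_slackness[OF l1 feas v lag]
  define g where "g = gfam f lam laminf"
  obtain U1 where U1: "open U1" "xb \<in> U1" "\<And>t x. x \<in> U1 \<Longrightarrow> lsc_at (g t) x"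
    "\<And>t. \<exists>b::real. \<forall>x\<in>U1. ereal b \<le> g t x"
    using i unfolding g_def by blast
  obtain b :: "enat \<Rightarrow> real" where b: "\<And>t x. x \<in> U1 \<Longrightarrow> ereal (b t) \<le> g t x"
    using U1(4) by metis
  obtain U2 where U2: "open U2" "xb \<in> U2" "uniformly_lsc_on U2 g"
    using ii unfolding g_def by blast
  have "ereal v \<le> (INF x\<in>U2. sum_bar g x)"
    unfolding g_def by (intro INF_greatest lagrangian_le_sum_bar not_MInf l1 lag)
  then have Lambda: "ereal v \<le> Lambda_U U2 g"
    using U2(3) unfolding uniformly_lsc_on_def by (rule order_trans)
  obtain \<rho> where \<rho>: "0 < \<rho>" "cball xb \<rho> \<subseteq> U1 \<inter> U2"
    using open_contains_cball[of "U1 \<inter> U2"] U1(1,2) U2(1,2) by blast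
  have g_convex: "convex_efun (g t)" for t
  proof (cases t)
    case (enat k)
    then show ?thesis
      using conv lam_nonneg by (cases "k = 0") (auto simp: g_def gfam_simps intro!: convex_efun_smul)
  next
    case infinity
    then show ?thesis
      using conv l1(2) by (auto simp: g_def gfam_simps intro!: convex_efun_smul convex_efun_finf)
  qed
  \<comment> \<open>Every finite sum at \<open>xb\<close> that contains index 0 therefore equals
    \<open>v\<close>, so the starting value for Ekeland's principle is the same for all n.\<close>
  have g_xb: "g t xb = (if t = 0 then ereal v else 0)" for t
    using slack v by (cases t) (auto simp: g_def gfam_simps zero_enat_def)
  have g_not_MInf: "g t x \<noteq> - \<infinity>" for t x
  proof (rule convex_efun_not_MInf[OF g_convex _ \<rho>(1)])
    show "g t xb < \<infinity>" by (simp add: g_xb)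
    show "g t x \<noteq> - \<infinity>" if "dist xb x \<le> \<rho>" for x
      using b[of x t] \<rho>(2) that by auto
  qed
  have main: "\<exists>n::nat. real n > M \<and>
       (\<exists>xs::nat \<Rightarrow> 'a. \<exists>xi::'a.
          (\<forall>k\<le>n. xs k \<in> ball xb \<epsilon>) \<and> xi \<in> ball xb \<epsilon> \<and>
          f 0 (xs 0) + (\<Sum>k\<in>{1..n}. smul (lam k) (f k (xs k))) + smul laminf (finf f xi) \<le> f 0 xb \<and>
          (\<exists>y0 ys yi. y0 \<in> subdiff (f 0) (xs 0) \<and>
             (\<forall>k\<in>{1..n}. ys k \<in> scaled_subdiff (lam k) (f k) (xs k)) \<and>
             yi \<in> scaled_subdiff laminf (finf f) xi \<and>
             norm (y0 + (\<Sum>k\<in>{1..n}. ys k) + yi) < \<epsilon>))"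
    if \<epsilon>: "0 < \<epsilon>" for \<epsilon> M :: real
  proof -
    define r where "r = min \<rho> \<epsilon> / 2"
    have r: "0 < r" "r < \<rho>" "r < \<epsilon>" using \<rho>(1) \<epsilon> by (auto simp: r_def)
    \<comment> \<open>Chosen so that the subgradient bound \<open>\<eta> / r\<close> equals
      \<open>\<epsilon> / 2\<close>.\<close>
    define \<eta> where "\<eta> = \<epsilon> * r / 2"
    have \<eta>: "0 < \<eta>" "\<eta> / r < \<epsilon>" using r \<epsilon> by (auto simp: \<eta>_def)
    obtain S0 where S0: "finite S0"
      "\<And>S. finite S \<Longrightarrow> S0 \<subseteq> S \<Longrightarrow> \<exists>\<delta>>0. \<forall>xs. (\<forall>t\<in>S. xs t \<in> U2) \<and> diameter (xs ` S) < \<delta> \<longrightarrow>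
        ereal (v - \<eta>) \<le> (\<Sum>t\<in>S. g t (xs t))"
      using Lambda_U_geD[OF Lambda \<eta>(1)] by metis
    obtain n0 where n0: "\<And>n. n0 \<le> n \<Longrightarrow> S0 \<subseteq> insert \<infinity> (enat ` {..n})"
      using finite_enat_subset[OF S0(1)] by metis
    obtain n1 where n1: "M < real n1" using reals_Archimedean2 by blast
    define n where "n = max n0 n1"
    define S where "S = insert \<infinity> (enat ` {..n})"
    have "finite S" "S0 \<subseteq> S" using n0[of n] by (auto simp: S_def n_def)
    then obtain \<delta> where \<delta>: "0 < \<delta>" and near: "\<And>xs. (\<forall>t\<in>S. xs t \<in> U2) \<Longrightarrow> diameter (xs ` S) < \<delta> \<Longrightarrow>
        ereal (v - \<eta>) \<le> (\<Sum>t\<in>S. g t (xs t))"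
      using S0(2)[of S] by blast
    \<comment> \<open>Renumbers the finite family by 0, ..., n + 1, the last number standing for the
      index \<infinity>.\<close>
    define \<iota> where "\<iota> t = (if t \<le> n then enat t else \<infinity>)" for t
    have split: "(\<Sum>t\<le>Suc n. F t) = F 0 + (\<Sum>k\<in>{1..n}. F k) + F (Suc n)"
      for F :: "nat \<Rightarrow> 'c::comm_monoid_add"
      by (simp add: atMost_atLeast0 sum.atLeast_Suc_atMost)
    have sum_\<iota>: "(\<Sum>t\<le>Suc n. g (\<iota> t) (z t)) =
        f 0 (z 0) + (\<Sum>k\<in>{1..n}. smul (lam k) (f k (z k))) + smul laminf (finf f (z (Suc n)))" for z
      unfolding split by (simp add: \<iota>_def g_def gfam_simps)
    have fuzzy: "\<exists>y X. (\<forall>t\<le>Suc n. dist xb (y t) \<le> r \<and> g (\<iota> t) (y t) < \<infinity> \<and> X t \<in> subdiff (g (\<iota> t)) (y t)) \<and>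
        (\<Sum>t\<le>Suc n. g (\<iota> t) (y t)) \<le> ereal v \<and> norm (\<Sum>t\<le>Suc n. X t) \<le> \<eta> / r"
    \<comment> \<open>Distances below \<open>\<delta> / 4\<close> to a common point give diameter at
      most \<open>\<delta> / 2\<close>, strictly below \<delta> as \<open>near\<close>
      demands.\<close>
    proof (rule fuzzy_fermat_rule[where \<rho> = \<rho> and b = "\<lambda>t. b (\<iota> t)" and \<delta> = "\<delta> / 4"])
      show "lsc_at (g (\<iota> t)) x" if "x \<in> cball xb \<rho>" for t x
        using that \<rho>(2) by (intro U1(3)) auto
      show "ereal (b (\<iota> t)) \<le> g (\<iota> t) x" if "x \<in> cball xb \<rho>" for t x
        using that \<rho>(2) by (intro b) auto
      show "(\<Sum>t\<le>Suc n. g (\<iota> t) xb) = ereal v"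
        unfolding sum_\<iota> using slack v by simp
      fix z assume z: "\<And>t. t \<le> Suc n \<Longrightarrow> z t \<in> cball xb \<rho>" "\<And>t. t \<le> Suc n \<Longrightarrow> dist (z t) (z 0) < \<delta> / 4"
      define xs where "xs t = (case t of enat k \<Rightarrow> z k | \<infinity> \<Rightarrow> z (Suc n))" for t
      have xs_S: "xs ` S = z ` {..Suc n}"
        by (auto simp: xs_def S_def image_iff le_Suc_eq)
      have "diameter (xs ` S) \<le> \<delta> / 2"
      proof (rule diameter_le)
        fix p q assume "p \<in> xs ` S" "q \<in> xs ` S"
        then have "dist p (z 0) < \<delta> / 4" "dist q (z 0) < \<delta> / 4"
          using z(2) by (auto simp: xs_S)
        then show "norm (p - q) \<le> \<delta> / 2"
          using dist_triangle2[of p q "z 0"] by (simp add: dist_norm)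
      qed (use \<delta> in simp)
      moreover have "xs ` S \<subseteq> U2"
        using z(1) \<rho>(2) unfolding xs_S by auto
      ultimately have "ereal (v - \<eta>) \<le> (\<Sum>t\<in>S. g t (xs t))"
        using \<delta> by (intro near) (auto simp: image_subset_iff)
      also have "\<dots> = (\<Sum>t\<le>Suc n. g (\<iota> t) (z t))"
        unfolding S_def sum_insert_infinity_enat sum_\<iota> by (simp add: xs_def g_def gfam_simps)
      finally show "ereal (v - \<eta>) \<le> (\<Sum>t\<le>Suc n. g (\<iota> t) (z t))" .
    qed (use g_convex g_not_MInf g_xb r \<eta> \<delta> in auto)
    obtain y X where y: "\<And>t. t \<le> Suc n \<Longrightarrow> dist xb (y t) \<le> r" "\<And>t. t \<le> Suc n \<Longrightarrow> g (\<iota> t) (y t) < \<infinity>"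
      "(\<Sum>t\<le>Suc n. g (\<iota> t) (y t)) \<le> ereal v"
      and X: "\<And>t. t \<le> Suc n \<Longrightarrow> X t \<in> subdiff (g (\<iota> t)) (y t)" "norm (\<Sum>t\<le>Suc n. X t) \<le> \<eta> / r"
      using fuzzy by blast
    have X_scaled: "X k \<in> scaled_subdiff (lam k) (f k) (y k)" if k: "k \<in> {1..n}" for k
      using k X(1)[of k] y(2)[of k] g_not_MInf[of "\<iota> k" "y k"]
      by (intro subdiff_smul_subset_scaled_subdiff lam_nonneg) (auto simp: \<iota>_def g_def gfam_simps)
    have X_inf: "X (Suc n) \<in> scaled_subdiff laminf (finf f) (y (Suc n))"
      using X(1)[of "Suc n"] y(2)[of "Suc n"] g_not_MInf[of \<infinity> "y (Suc n)"]
      by (intro subdiff_smul_subset_scaled_subdiff l1) (auto simp: \<iota>_def g_def gfam_simps)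
    have X_0: "X 0 \<in> subdiff (f 0) (y 0)"
      using X(1)[of 0] by (simp add: \<iota>_def g_def gfam_simps)
    have "norm (X 0 + (\<Sum>k\<in>{1..n}. X k) + X (Suc n)) < \<epsilon>"
      using X(2) \<eta>(2) unfolding split by linarith
    moreover have "y t \<in> ball xb \<epsilon>" if "t \<le> Suc n" for t
      using y(1)[OF that] r(3) by simp
    moreover have "M < real n" using n1 by (simp add: n_def)
    moreover have "f 0 (y 0) + (\<Sum>k\<in>{1..n}. smul (lam k) (f k (y k))) + smul laminf (finf f (y (Suc n))) \<le> f 0 xb"
      using y(3) unfolding sum_\<iota> v .
    ultimately show ?thesis
      using X_0 X_scaled X_inf by (intro exI[of _ n] conjI exI[of _ y] exI[of _ "y (Suc n)"]
          exI[of _ "X 0"] exI[of _ X] exI[of _ "X (Suc n)"]) auto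
  qed
  show ?thesis using slack main by blast
qed

end
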